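(* Let $H$ be a factorial monoid and let $M\subset H$ be a submonoid such that $M^{\times}=H^{\times}$. The following conditions are equivalent: (i) $\mathcal{S}(M)\subset\mathcal{S}(H)$; (ii) $\mathcal{A}(M)\subset\mathcal{S}(H)$ and, for every $a,b\in M$, if $a,b$ are relatively prime in $M$, then $a,b$ are relatively prime in $H$; (iii) $\mathcal{A}(M)\subset\mathcal{S}(H)$ and, for every $a,b\in\mathcal{A}(M)$, if $a\nsim_M b$, then $a,b$ are relatively prime in $H$; (iv) there is a set $B$ of pairwise relatively prime (in $H$) non-invertible square-free elements of $H$ such that $M=H^{\times}\times\mathsf{F}(B)$; (v) for every $n\geq 1$ and $s_1,\dots,s_n\in\mathcal{S}(H)$ such that $s_i,s_j$ are relatively prime in $H$ for all $i\neq j$: if $s_1s_2^2s_3^3\cdots s_n^n\in M$, then $s_1,s_2,\dots,s_n\in M$; (vi) for every $n\geq 1$, $k_1,\dots,k_n\geq 0$ and $q_1,\dots,q_n\in\mathcal{A}(H)$ such that $q_i\nsim_H q_j$ for $i\neq j$: if $q_1^{k_1}\cdots q_n^{k_n}\in M$, then $q_1^{c_i^{(1)}}\cdots q_n^{c_i^{(n)}}\in M$ for each $i=0,\dots,r$, where $k_j=c_r^{(j)}2^r+\dots+c_0^{(j)}2^0$ for $j=1,\dots,n$, with $c_i^{(j)}\in\{0,1\}$ for $i=0,\dots,r$ (binary expansions with a common length $r+1$); (vii) for every $n\geq 0$ and $s_0,\dots,s_n\in\mathcal{S}(H)$: if $s_n^{2^n}\cdots s_1^2s_0\in M$, then $s_0,\dots,s_n\in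 M$; (viii) for every $a\in H$ and $b\in\mathcal{S}(H)$: $a^2b\in M\Rightarrow a\in M$ and $b\in M$.
   Context: Monoid means commutative cancellative monoid (written multiplicatively). $H^{\times}$ denotes the group of invertible elements of $H$. An atom is a non-invertible element that is not a product of two non-invertible elements; $\mathcal{A}(H)$ is the set of atoms of $H$. A monoid is factorial if every non-invertible element is a finite product of atoms, uniquely up to order and invertible factors. An element $a\in H$ is square-free if it cannot be written as $a=b^2c$ with $b,c\in H$ and $b\notin H^{\times}$; $\mathcal{S}(H)$ is the set of square-free elements of $H$. $\mathcal{A}(M)$, $\mathcal{S}(M)$ are the corresponding sets for $M$ regarded as a monoid in its own right. Two elements are relatively prime in a monoid if they have no common non-invertible divisor in that monoid (divisibility taken in that monoid). $a\sim_H b$ means $a=ub$ for some $u\in H^{\times}$ (similarly $\sim_M$). $\mathsf{F}(B)$ denotes the free commutative monoid with basis $B$; the equality $M=H^{\times}\times\mathsf{F}(B)$ means that $M$ consists exactly of the elements $u\prod_{b\in B}b^{k_b}$ with $u\in H^{\times}$, $k_b\in\mathbb{Z}_{\geq 0}$, almost all $k_b=0$, and that this representation is unique. *)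

theory Defs
  imports "HOL-Algebra.Divisibility" "HOL-Algebra.FiniteProduct"
begin

text \<open>
  Every notion below takes a monoid record. For a submonoid \<open>M\<close> of \<open>H\<close> it is applied to
  \<open>H\<lparr>carrier := M\<rparr>\<close>, so that units, divisors and cofactors are then taken in \<open>M\<close>.
\<close>

definition atoms :: "('a, 'b) monoid_scheme \<Rightarrow> 'a set"
  where "atoms G = {a \<in> carrier G. irreducible G a}"

definition squarefree_elems :: "('a, 'b) monoid_scheme \<Rightarrow> 'a set"
  where "squarefree_elems G =
    {a \<in> carrier G. \<not> (\<exists>b\<in>carrier G. \<exists>c\<in>carrier G. b \<notin> Units G \<and> a = b [^]\<^bsub>G\<^esub> (2::nat) \<otimes>\<^bsub>G\<^esub> c)}"

definition rel_prime :: "('a, 'b) monoid_scheme \<Rightarrow> 'a \<Rightarrow> 'a \<Rightarrow> bool"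
  where "rel_prime G a b \<longleftrightarrow>
    \<not> (\<exists>d\<in>carrier G. d \<notin> Units G \<and> d divides\<^bsub>G\<^esub> a \<and> d divides\<^bsub>G\<^esub> b)"

text \<open>
  The equality \<open>M = G\<^sup>\<times> \<times> F(B)\<close> inside \<open>G\<close>: a finitely supported exponent family on \<open>B\<close> is
  a function that is zero outside \<open>B\<close> and nonzero at finitely many points, and surjectivity and
  injectivity of the product map are existence and uniqueness of the representation.
\<close>

definition units_times_free :: "('a, 'b) monoid_scheme \<Rightarrow> 'a set \<Rightarrow> 'a set \<Rightarrow> bool"
  where "units_times_free G M B \<longleftrightarrow>
    bij_betw (\<lambda>(u, k). u \<otimes>\<^bsub>G\<^esub> (\<Otimes>\<^bsub>G\<^esub>b\<in>{b. k b \<noteq> 0}. b [^]\<^bsub>G\<^esub> k b))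
      (Units G \<times> {k :: 'a \<Rightarrow> nat. finite {b. k b \<noteq> 0} \<and> {b. k b \<noteq> 0} \<subseteq> B}) M"

text \<open>
  In a commutative cancellative monoid the library's \<open>irreducible\<close> elements are the non-invertible
  elements that are not a product of two non-invertible ones, and the library's \<open>associated\<close> is
  equality up to a unit (\<open>associated_iff\<close>). A submonoid is again cancellative.
\<close>

lemma (in comm_monoid_cancel) atoms_eq:
  "atoms G = {a \<in> carrier G. a \<notin> Units G \<and>
    \<not> (\<exists>b\<in>carrier G. \<exists>c\<in>carrier G. b \<notin> Units G \<and> c \<notin> Units G \<and> a = b \<otimes> c)}"
proof -
  have "irreducible G a \<longleftrightarrow> a \<notin> Units G \<and>
      \<not> (\<exists>b\<in>carrier G. \<exists>c\<in>carrier G. b \<notin> Units G \<and> c \<notin> Units G \<and> a = b \<otimes> c)" (is "_ \<longleftrightarrow> ?R")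
    if a: "a \<in> carrier G" for a
  proof
    assume irr: "irreducible G a"
    show ?R
    proof (intro conjI notI)
      assume "a \<in> Units G"
      with irr show False by (simp add: irreducible_def)
    next
      assume "\<exists>b\<in>carrier G. \<exists>c\<in>carrier G. b \<notin> Units G \<and> c \<notin> Units G \<and> a = b \<otimes> c"
      then obtain b c where bc: "b \<in> carrier G" "c \<in> carrier G" "b \<notin> Units G" "c \<notin> Units G" "a = b \<otimes> c"
        by blast
      have "b divides a" using bc by (auto simp: factor_def)
      moreover have "\<not> a divides b"
        using bc a by (metis \<open>b divides a\<close> associatedI associatedD2 l_cancel Units_closed)
      ultimately have "properfactor G b a" by (simp add: properfactor_def)
      with irr bc show False by (simp add: irreducible_def)
    qed
  next
    assume R: ?R
    show "irreducible G a"
      unfolding irreducible_def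
    proof (intro conjI ballI impI)
      show "a \<notin> Units G" using R by blast
      fix b assume b: "b \<in> carrier G" and pf: "properfactor G b a"
      then obtain c where c: "c \<in> carrier G" "a = b \<otimes> c"
        by (auto simp: properfactor_def factor_def)
      show "b \<in> Units G"
      proof (rule ccontr)
        assume "b \<notin> Units G"
        with R b c have "c \<in> Units G" by blast
        with b c have "a \<sim> b" by (blast intro: associatedI2')
        with pf show False by (simp add: properfactor_def associated_def)
      qed
    qed
  qed
  then show ?thesis by (auto simp: atoms_def)
qed

lemma (in comm_monoid_cancel) submonoid_comm_monoid_cancel:
  assumes "submonoid M G"
  shows "comm_monoid_cancel (G\<lparr>carrier := M\<rparr>)"
proof -
  interpret M: submonoid M G by fact
  have sub: "x \<in> carrier G" if "x \<in> M" for x using that M.subset by blast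
  show ?thesis
  proof (rule comm_monoid_cancelI)
    show "comm_monoid (G\<lparr>carrier := M\<rparr>)"
      by (rule comm_monoidI) (auto simp: sub m_ac)
    show "a = b" if "a \<otimes>\<^bsub>G\<lparr>carrier := M\<rparr>\<^esub> c = b \<otimes>\<^bsub>G\<lparr>carrier := M\<rparr>\<^esub> c"
      "a \<in> carrier (G\<lparr>carrier := M\<rparr>)" "b \<in> carrier (G\<lparr>carrier := M\<rparr>)"
      "c \<in> carrier (G\<lparr>carrier := M\<rparr>)" for a b c
      using that r_cancel[of a c b] by (simp add: sub)
  qed
qed

end

theory Submission
  imports Defs
begin

text \<open>
  In \<open>H\<close> everything is read off prime multiplicities: \<open>a\<close> is square-free iff all multiplicities
  are at most 1, and \<open>a\<close>, \<open>b\<close> are relatively prime iff no prime has positive multiplicity in both.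
  If square-free elements of \<open>M\<close> stay square-free in \<open>H\<close>, then a minimal pair of non-associated
  atoms of \<open>M\<close> with a common prime yields a smaller such pair, so non-associated atoms are
  relatively prime and a set of representatives of the atoms is a basis \<open>B\<close>. Conversely, for
  \<open>m = u \<Prod> b^k(b)\<close> with such a basis, the multiplicity of a prime dividing \<open>b\<close> in \<open>m\<close> is \<open>k(b)\<close>, so for
  every \<open>g\<close> with \<open>g(0) = 0\<close> some element of \<open>M\<close> has the multiplicities \<open>g(v(m))\<close>. Taking for \<open>g\<close>
  halving, parity and the indicator of \<open>i\<close> gives the closure properties (viii) and (v), and iterating
  (viii) gives (vii) and (vi). Each closure property, applied to a square-free element of \<open>M\<close>, exhibits
  a square factor in \<open>M\<close>, which is then a unit.
\<close>

section \<open>Multisets of primes in a factorial monoid\<close>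

context factorial_monoid
begin

text \<open>The elements of \<open>prime_mset a\<close> are association classes of primes, not primes.\<close>

definition prime_mset :: "'a \<Rightarrow> 'a set multiset"
  where "prime_mset a = fmset G (SOME fs. set fs \<subseteq> carrier G \<and> wfactors G fs a)"

abbreviation mlt :: "'a set \<Rightarrow> 'a \<Rightarrow> nat"
  where "mlt p a \<equiv> count (prime_mset a) p"

lemma prime_mset_wfactors:
  assumes "a \<in> carrier G"
  obtains fs where "set fs \<subseteq> carrier G" "wfactors G fs a" "prime_mset a = fmset G fs"
  using someI_ex[OF wfactors_exist[OF assms]] unfolding prime_mset_def by blast

lemma prime_mset_mult:
  assumes "a \<in> carrier G" "b \<in> carrier G"
  shows "prime_mset (a \<otimes> b) = prime_mset a + prime_mset b"
proof -
  obtain fa where "set fa \<subseteq> carrier G" "wfactors G fa a" "prime_mset a = fmset G fa"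
    using assms prime_mset_wfactors by blast
  moreover obtain fb where "set fb \<subseteq> carrier G" "wfactors G fb b" "prime_mset b = fmset G fb"
    using assms prime_mset_wfactors by blast
  moreover obtain fc where "set fc \<subseteq> carrier G" "wfactors G fc (a \<otimes> b)" "prime_mset (a \<otimes> b) = fmset G fc"
    using assms prime_mset_wfactors by (metis m_closed)
  ultimately show ?thesis
    using mult_wfactors_fmset assms by metis
qed

lemma divides_iff_prime_mset:
  assumes "a \<in> carrier G" "b \<in> carrier G"
  shows "a divides b \<longleftrightarrow> prime_mset a \<subseteq># prime_mset b"
proof -
  obtain fa where "set fa \<subseteq> carrier G" "wfactors G fa a" "prime_mset a = fmset G fa"
    using assms prime_mset_wfactors by blast
  moreover obtain fb where "set fb \<subseteq> carrier G" "wfactors G fb b" "prime_mset b = fmset G fb"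
    using assms prime_mset_wfactors by blast
  ultimately show ?thesis
    using divides_as_fmsubset assms by metis
qed

lemma associated_iff_prime_mset:
  assumes "a \<in> carrier G" "b \<in> carrier G"
  shows "a \<sim> b \<longleftrightarrow> prime_mset a = prime_mset b"
  using assms by (auto simp: associated_def divides_iff_prime_mset)

lemma prime_mset_one: "prime_mset \<one> = {#}"
  \<comment> \<open>From \<open>\<one> \<otimes> \<one> = \<one>\<close>, the multiset equals its
    own double.\<close>
  using prime_mset_mult[of \<one> \<one>] by simp

lemma prime_mset_eq_empty_iff:
  assumes "a \<in> carrier G"
  shows "prime_mset a = {#} \<longleftrightarrow> a \<in> Units G"
  using assms Unit_eq_dividesone[of a] divides_iff_prime_mset[of a \<one>] prime_mset_one by simp

lemma non_unit_mlt:
  assumes "a \<in> carrier G" "a \<notin> Units G"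
  obtains p where "mlt p a > 0"
  using assms prime_mset_eq_empty_iff by (metis multiset_nonemptyE count_greater_zero_iff)

lemma mlt_mult:
  assumes "a \<in> carrier G" "b \<in> carrier G"
  shows "mlt p (a \<otimes> b) = mlt p a + mlt p b"
  using assms by (simp add: prime_mset_mult)

lemma mlt_unit_mult:
  assumes "u \<in> Units G" "a \<in> carrier G"
  shows "mlt p (u \<otimes> a) = mlt p a"
  using assms prime_mset_eq_empty_iff[of u] by (simp add: mlt_mult Units_closed)

lemma mlt_pow:
  assumes "a \<in> carrier G"
  shows "mlt p (a [^] (n::nat)) = n * mlt p a"
  using assms by (induction n) (simp_all add: prime_mset_one prime_mset_mult)

lemma mlt_finprod:
  assumes "finite I" "\<And>i. i \<in> I \<Longrightarrow> f i \<in> carrier G"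
  shows "mlt p (\<Otimes>i\<in>I. f i) = (\<Sum>i\<in>I. mlt p (f i))"
  using assms
proof (induction I)
  case (insert i I)
  then show ?case by (subst finprod_insert) (auto simp: prime_mset_mult)
qed (simp add: prime_mset_one)

lemma mlt_finprod_pow:
  assumes "finite I" "\<And>i. i \<in> I \<Longrightarrow> f i \<in> carrier G"
  shows "mlt p (\<Otimes>i\<in>I. f i [^] (k i :: nat)) = (\<Sum>i\<in>I. k i * mlt p (f i))"
  using assms by (simp add: mlt_finprod mlt_pow)

lemma associatedI_mlt:
  assumes "a \<in> carrier G" "b \<in> carrier G" "\<And>p. mlt p a = mlt p b"
  shows "a \<sim> b"
  using assms by (simp add: associated_iff_prime_mset multiset_eq_iff)

lemma dividesI_mlt:
  assumes "a \<in> carrier G" "b \<in> carrier G" "\<And>p. mlt p a \<le> mlt p b"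
  shows "a divides b"
  using assms by (simp add: divides_iff_prime_mset mset_subset_eqI)

text \<open>Not every multiset of sets comes from an element. The bound on the support makes each
  member of \<open>X\<close> the class of an irreducible factor of \<open>a\<close>, so a product of
  representatives exists.\<close>

lemma prime_mset_surj:
  assumes "a \<in> carrier G" "set_mset X \<subseteq> set_mset (prime_mset a)"
  obtains b where "b \<in> carrier G" "prime_mset b = X"
proof -
  obtain fa where fa: "set fa \<subseteq> carrier G" "wfactors G fa a" "prime_mset a = fmset G fa"
    using assms prime_mset_wfactors by blast
  have "\<exists>b fs. b \<in> carrier G \<and> set fs \<subseteq> carrier G \<and> wfactors G fs b \<and> fmset G fs = X"
  proof (rule mset_wfactorsEx)
    fix p assume "p \<in># X"
    then have "p \<in> assocs G ` set fa" using assms fa by (auto simp: fmset_def)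
    then show "\<exists>x. (x \<in> carrier G \<and> irreducible G x) \<and> p = assocs G x"
      using fa by (auto simp: wfactors_def)
  qed
  then obtain b fs where b: "b \<in> carrier G" "set fs \<subseteq> carrier G" "wfactors G fs b" "fmset G fs = X"
    by blast
  obtain fb where "set fb \<subseteq> carrier G" "wfactors G fb b" "prime_mset b = fmset G fb"
    using b prime_mset_wfactors by blast
  \<comment> \<open>The list \<open>fs\<close> need not be the one behind
    \<open>prime_mset b\<close>; uniqueness of factorisation identifies the two multisets.\<close>
  with b have "prime_mset b = X"
    by (metis ee_fmset wfactors_unique)
  with b show thesis using that by blast
qed

text \<open>Turns a class \<open>p\<close> back into an element, so that divisibility by that prime
  can be expressed.\<close>

lemma prime_of_mlt_pos:
  assumes "a \<in> carrier G" "mlt p a > 0"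
  obtains q where "q \<in> carrier G" "prime_mset q = {#p#}"
  using prime_mset_surj[OF assms(1), of "{#p#}"] assms(2) by auto

text \<open>An atom is divisible by some \<open>q\<close> with singleton multiset; \<open>q\<close>
  is no unit, so the cofactor is one. Conversely, a singleton is a sum of two multisets only if one
  of them is empty.\<close>

lemma atom_iff_prime_mset:
  assumes "a \<in> carrier G"
  shows "a \<in> atoms G \<longleftrightarrow> (\<exists>p. prime_mset a = {#p#})"
proof
  assume a: "a \<in> atoms G"
  then have nu: "a \<notin> Units G" by (auto simp: atoms_eq)
  then obtain p where p: "mlt p a > 0" using assms non_unit_mlt by blast
  then obtain q where q: "q \<in> carrier G" "prime_mset q = {#p#}" using assms prime_of_mlt_pos by blast
  have "q divides a" using p q assms by (simp add: divides_iff_prime_mset)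
  then obtain c where c: "c \<in> carrier G" "a = q \<otimes> c" by auto
  have "q \<notin> Units G" using q prime_mset_eq_empty_iff[of q] by auto
  then have "c \<in> Units G" using a c q by (auto simp: atoms_eq)
  then show "\<exists>p. prime_mset a = {#p#}"
    using c q prime_mset_eq_empty_iff[of c] by (simp add: prime_mset_mult)
next
  assume "\<exists>p. prime_mset a = {#p#}"
  then obtain p where p: "prime_mset a = {#p#}" by blast
  show "a \<in> atoms G"
    unfolding atoms_eq
  proof (clarify, intro conjI notI)
    show "a \<in> carrier G" by fact
    show False if "a \<in> Units G" using that p prime_mset_eq_empty_iff[OF assms] by simp
    show False if "\<exists>b\<in>carrier G. \<exists>c\<in>carrier G. b \<notin> Units G \<and> c \<notin> Units G \<and> a = b \<otimes> c"
      using that p by (auto simp: prime_mset_mult prime_mset_eq_empty_iff[symmetric] union_is_single)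
  qed
qed

lemma associatedE_unit:
  assumes "a \<sim> b" "a \<in> carrier G" "b \<in> carrier G"
  obtains u where "u \<in> Units G" "a = b \<otimes> u"
  using assms associatedE2 by blast

text \<open>The number of prime factors, counted with multiplicity, is the measure for every
  induction on elements; this form of decrease serves the descent on pairs of atoms.\<close>

lemma size_less_of_mlt_le:
  assumes "a \<in> carrier G" "b \<in> carrier G" "\<And>p. mlt p a \<le> mlt p b" "\<not> a \<sim> b"
  shows "size (prime_mset a) < size (prime_mset b)"
  using assms by (intro mset_subset_size) (auto simp: subset_mset_def associated_iff_prime_mset intro: mset_subset_eqI)

lemma size_less_mult:
  assumes "a \<in> carrier G" "b \<in> carrier G" "a \<notin> Units G"
  shows "size (prime_mset b) < size (prime_mset (a \<otimes> b))"
  using assms by (auto simp: prime_mset_mult prime_mset_eq_empty_iff[symmetric] nonempty_has_size)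

section \<open>Square-freeness and coprimality in terms of multiplicities\<close>

text \<open>A multiplicity above 1 lets the square of a prime in that class be split off. In the
  other direction, \<open>b [^] 2 \<otimes> c\<close> has multiplicity at least 2 at every prime of
  \<open>b\<close>, and a non-unit \<open>b\<close> has one.\<close>

lemma squarefree_iff_mlt:
  assumes "a \<in> carrier G"
  shows "a \<in> squarefree_elems G \<longleftrightarrow> (\<forall>p. mlt p a \<le> 1)"
proof
  assume a: "a \<in> squarefree_elems G"
  show "\<forall>p. mlt p a \<le> 1"
  proof (rule ccontr)
    assume "\<not> ?thesis"
    then obtain p where p: "mlt p a > 1" by (auto simp: not_le)
    then obtain q where q: "q \<in> carrier G" "prime_mset q = {#p#}"
      using assms prime_of_mlt_pos[of a p] by (metis less_trans zero_less_one)
    have "q [^] (2::nat) divides a"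
      using p q assms by (intro dividesI_mlt) (auto simp: mlt_pow)
    then obtain c where c: "c \<in> carrier G" "a = q [^] (2::nat) \<otimes> c" by auto
    have "q \<notin> Units G" using q prime_mset_eq_empty_iff[of q] by auto
    with a c q show False by (auto simp: squarefree_elems_def)
  qed
next
  assume le: "\<forall>p. mlt p a \<le> 1"
  show "a \<in> squarefree_elems G"
    unfolding squarefree_elems_def
  proof (clarify, intro conjI notI)
    assume "\<exists>b\<in>carrier G. \<exists>c\<in>carrier G. b \<notin> Units G \<and> a = b [^] (2::nat) \<otimes> c"
    then obtain b c where bc: "b \<in> carrier G" "c \<in> carrier G" "b \<notin> Units G" "a = b [^] (2::nat) \<otimes> c"
      by blast
    obtain p where "mlt p b > 0" using bc non_unit_mlt by blast
    moreover have "mlt p a = 2 * mlt p b + mlt p c" using bc by (simp add: mlt_mult mlt_pow)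
    moreover have "mlt p a \<le> 1" using le by blast
    ultimately show False by linarith
  qed fact
qed

text \<open>A shared prime is itself a common non-unit divisor, and any such divisor carries a
  prime.\<close>

lemma rel_prime_iff_mlt:
  assumes "a \<in> carrier G" "b \<in> carrier G"
  shows "rel_prime G a b \<longleftrightarrow> (\<forall>p. mlt p a = 0 \<or> mlt p b = 0)"
proof
  assume ab: "rel_prime G a b"
  show "\<forall>p. mlt p a = 0 \<or> mlt p b = 0"
  proof (rule ccontr)
    assume "\<not> ?thesis"
    then obtain p where p: "mlt p a > 0" "mlt p b > 0" by auto
    then obtain q where q: "q \<in> carrier G" "prime_mset q = {#p#}"
      using assms prime_of_mlt_pos by blast
    then have "q divides a" "q divides b" using p assms by (auto simp: divides_iff_prime_mset)
    moreover have "q \<notin> Units G" using q prime_mset_eq_empty_iff[of q] by auto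
    ultimately show False using ab q by (auto simp: rel_prime_def)
  qed
next
  assume z: "\<forall>p. mlt p a = 0 \<or> mlt p b = 0"
  show "rel_prime G a b"
    unfolding rel_prime_def
  proof
    assume "\<exists>d\<in>carrier G. d \<notin> Units G \<and> d divides a \<and> d divides b"
    then obtain d where d: "d \<in> carrier G" "d \<notin> Units G" "d divides a" "d divides b" by blast
    obtain p where "mlt p d > 0" using d non_unit_mlt by blast
    moreover have "mlt p d \<le> mlt p a" "mlt p d \<le> mlt p b"
      using d assms by (simp_all add: divides_iff_prime_mset mset_subset_eq_count)
    ultimately show False using z by (metis not_le)
  qed
qed

text \<open>Coprimality to \<open>b j\<close> removes \<open>p\<close> from all other factors, so a
  single summand survives. This evaluates products of basis elements, of the \<open>s i\<close> in
  (v), and of atoms at one prime.\<close>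

lemma sum_mlt_pairwise_coprime:
  assumes I: "finite I" "\<And>i. i \<in> I \<Longrightarrow> b i \<in> carrier G" "j \<in> I" "mlt p (b j) > 0"
    and cop: "\<And>i. i \<in> I \<Longrightarrow> i \<noteq> j \<Longrightarrow> rel_prime G (b i) (b j)"
  shows "(\<Sum>i\<in>I. k i * mlt p (b i)) = k j * mlt p (b j)"
proof -
  have "mlt p (b i) = 0" if "i \<in> I - {j}" for i
    using that I cop[of i] rel_prime_iff_mlt[of "b i" "b j"] by (metis DiffE insertI1 less_nat_zero_code)
  then have "(\<Sum>i\<in>I - {j}. k i * mlt p (b i)) = 0" by simp
  then show ?thesis using I by (simp add: sum.remove)
qed

lemma non_associated_atoms_coprime:
  assumes "a \<in> atoms G" "b \<in> atoms G" "\<not> a \<sim> b"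
  shows "rel_prime G a b"
proof -
  have ab: "a \<in> carrier G" "b \<in> carrier G" using assms by (auto simp: atoms_def)
  then obtain p q where "prime_mset a = {#p#}" "prime_mset b = {#q#}"
    using assms atom_iff_prime_mset by metis
  then show ?thesis
    using ab assms by (auto simp: rel_prime_iff_mlt associated_iff_prime_mset)
qed

section \<open>Elements whose multiplicities are a function of given ones\<close>

text \<open>The primes of \<open>s\<close> and their exponents in the index form of (vi). One pair
  \<open>q\<close>, \<open>k\<close> serves every \<open>g\<close>: the identity gives
  \<open>s\<close> back up to a unit, a digit function gives a digit product. The bound on
  \<open>k\<close> later yields a common length for the binary expansions.\<close>

lemma atom_enumeration:
  assumes s: "s \<in> carrier G"
  obtains n :: nat and q :: "nat \<Rightarrow> 'a" and k :: "nat \<Rightarrow> nat"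
  where "\<And>j. j \<in> {1..n} \<Longrightarrow> q j \<in> atoms G"
    and "\<And>i j. i \<in> {1..n} \<Longrightarrow> j \<in> {1..n} \<Longrightarrow> i \<noteq> j \<Longrightarrow> \<not> q i \<sim> q j"
    and "\<And>j. j \<in> {1..n} \<Longrightarrow> k j \<le> size (prime_mset s)"
    and "\<And>g p. g 0 = 0 \<Longrightarrow> mlt p (\<Otimes>j\<in>{1..n}. q j [^] (g (k j) :: nat)) = g (mlt p s)"
proof -
  define P where "P = set_mset (prime_mset s)"
  obtain h where h: "bij_betw h {1..card P} P"
    using ex_bij_betw_nat_finite_1[of P] by (auto simp: P_def)
  \<comment> \<open>\<open>n = 0\<close> happens exactly when \<open>s\<close> is a unit.\<close>
  define n where "n = card P"
  have hP: "h j \<in> P" if "j \<in> {1..n}" for j using h that by (auto simp: bij_betw_def n_def)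
  have "\<forall>j\<in>{1..n}. \<exists>q. q \<in> carrier G \<and> prime_mset q = {#h j#}"
    using hP prime_of_mlt_pos[OF s] by (metis P_def count_greater_zero_iff)
  then obtain q where q: "\<And>j. j \<in> {1..n} \<Longrightarrow> q j \<in> carrier G \<and> prime_mset (q j) = {#h j#}"
    by metis
  define k where "k j = mlt (h j) s" for j
  show thesis
  proof
    show "q j \<in> atoms G" if "j \<in> {1..n}" for j using q[OF that] atom_iff_prime_mset by blast
    show "\<not> q i \<sim> q j" if "i \<in> {1..n}" "j \<in> {1..n}" "i \<noteq> j" for i j
    proof -
      have "h i \<noteq> h j"
        using that inj_onD[OF bij_betw_imp_inj_on[OF h], of i j] by (auto simp: n_def)
      then show ?thesis
        using q[OF that(1)] q[OF that(2)] by (simp add: associated_iff_prime_mset)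
    qed
    show "k j \<le> size (prime_mset s)" if "j \<in> {1..n}" for j
      unfolding k_def by (rule count_le_size)
    show "mlt p (\<Otimes>j\<in>{1..n}. q j [^] (g (k j) :: nat)) = g (mlt p s)" if g: "g 0 = 0" for g p
    proof -
      have "mlt p (\<Otimes>j\<in>{1..n}. q j [^] (g (k j) :: nat)) = (\<Sum>j\<in>{1..n}. g (mlt (h j) s) * count {#h j#} p)"
        using q by (subst mlt_finprod_pow) (auto simp: k_def)
      also have "\<dots> = (\<Sum>x\<in>P. g (mlt x s) * count {#x#} p)"
        using h by (intro sum.reindex_bij_betw) (simp add: n_def)
      also have "\<dots> = (\<Sum>x\<in>P. if x = p then g (mlt p s) else 0)"
        by (intro sum.cong) auto
      \<comment> \<open>A class \<open>p\<close> outside \<open>P\<close> has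
        \<open>mlt p s = 0\<close>, and \<open>g 0 = 0\<close> agrees with the vanishing
        sum.\<close>
      also have "\<dots> = g (mlt p s)"
        using g by (auto simp: P_def not_in_iff)
      finally show ?thesis .
    qed
  qed
qed

text \<open>The enumeration is forgotten and only multiplicities are kept. With an indicator for
  \<open>g\<close> this isolates the primes of one given multiplicity.\<close>

lemma transform_mlt:
  assumes "s \<in> carrier G" "g 0 = (0::nat)"
  obtains t where "t \<in> carrier G" "\<And>p. mlt p t = g (mlt p s)"
proof -
  obtain n :: nat and q k where q: "\<And>j. j \<in> {1..n} \<Longrightarrow> q j \<in> atoms G"
    and m: "\<And>g p. g 0 = 0 \<Longrightarrow> mlt p (\<Otimes>j\<in>{1..n}. q j [^] (g (k j) :: nat)) = g (mlt p s)"
    using atom_enumeration[OF assms(1)] by metis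
  have "(\<Otimes>j\<in>{1..n}. q j [^] (g (k j) :: nat)) \<in> carrier G"
    using q by (intro finprod_closed) (auto simp: atoms_def)
  with m[of g] assms show thesis using that by blast
qed

end

text \<open>Induction on the number of digits: the lowest digit is \<open>k mod 2\<close>, and the
  others are the digits of \<open>k div 2\<close>.\<close>

lemma sum_binary_digits: "k < 2 ^ n \<Longrightarrow> (\<Sum>i<n. (k div 2 ^ i mod 2) * 2 ^ i) = (k::nat)"
proof (induction n arbitrary: k)
  case (Suc n)
  have "(\<Sum>i<Suc n. (k div 2 ^ i mod 2) * 2 ^ i) = k mod 2 + 2 * (\<Sum>i<n. (k div 2 div 2 ^ i mod 2) * 2 ^ i)"
    by (subst sum.lessThan_Suc_shift) (simp add: sum_distrib_left div_mult2_eq mult_ac)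
  also have "\<dots> = k mod 2 + 2 * (k div 2)"
    using Suc.prems by (subst Suc.IH) auto
  finally show ?case by simp
qed simp

section \<open>A submonoid with the same units\<close>

locale unit_submonoid = factorial_monoid +
  fixes M :: "'a set"
  assumes submonoid: "submonoid M G"
    and Units_submonoid: "Units (G\<lparr>carrier := M\<rparr>) = Units G"
begin

abbreviation GM where "GM \<equiv> G\<lparr>carrier := M\<rparr>"

text \<open>The rewrites state facts about \<open>M\<close> with the multiplication and the units of
  \<open>G\<close>. What still differs between the two monoids is where divisors and cofactors
  range.\<close>

sublocale M: comm_monoid_cancel GM
  rewrites "carrier GM = M" and "x \<otimes>\<^bsub>GM\<^esub> y = x \<otimes> y" and "\<one>\<^bsub>GM\<^esub> = \<one>" and "Units GM = Units G"
  using submonoid_comm_monoid_cancel[OF submonoid] Units_submonoid by simp_all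

lemma sub_closed: "a \<in> M \<Longrightarrow> a \<in> carrier G"
  using submonoid submonoid.subset by blast

lemma Units_in: "u \<in> Units G \<Longrightarrow> u \<in> M"
  using Units_submonoid unfolding Units_def by auto

lemma pow_in: "a \<in> M \<Longrightarrow> a [^] (n::nat) \<in> M"
  by (induction n) auto

lemma finprod_in:
  assumes "finite I" "\<And>i. i \<in> I \<Longrightarrow> f i \<in> M"
  shows "(\<Otimes>i\<in>I. f i) \<in> M"
  using assms
proof (induction I)
  case (insert i I)
  then show ?case by (subst finprod_insert) (auto intro: sub_closed)
qed simp

lemma finprod_pow_in:
  assumes "finite I" "\<And>i. i \<in> I \<Longrightarrow> f i \<in> M"
  shows "(\<Otimes>i\<in>I. f i [^] (k i :: nat)) \<in> M"
  using assms by (simp add: finprod_in pow_in)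

text \<open>Equal multiplicities leave only a unit between \<open>a\<close> and \<open>b\<close>,
  and \<open>M\<close> contains all units of \<open>G\<close>. Membership in \<open>M\<close> can
  therefore be tested on multiplicities.\<close>

lemma in_cong:
  assumes "a \<in> M" "b \<in> carrier G" "\<And>p. mlt p b = mlt p a"
  shows "b \<in> M"
proof -
  have "b \<sim> a" using assms sub_closed by (intro associatedI_mlt) auto
  then obtain u where "u \<in> Units G" "b = a \<otimes> u" using assms sub_closed associatedE_unit by blast
  then show ?thesis using assms Units_in by blast
qed

text \<open>Both relations are equality up to a unit, and the unit groups coincide.\<close>

lemma associated_sub_iff:
  assumes "a \<in> M" "b \<in> M"
  shows "a \<sim>\<^bsub>GM\<^esub> b \<longleftrightarrow> a \<sim> b"
  using assms associated_iff[of a b] M.associated_iff[of a b] sub_closed by auto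

lemma atoms_sub:
  "a \<in> atoms GM \<longleftrightarrow> a \<in> M \<and> a \<notin> Units G \<and>
    (\<forall>b\<in>M. \<forall>c\<in>M. a = b \<otimes> c \<longrightarrow> b \<in> Units G \<or> c \<in> Units G)"
  using M.atoms_eq by auto

lemma squarefree_sub:
  "a \<in> squarefree_elems GM \<longleftrightarrow> a \<in> M \<and> (\<forall>b\<in>M. \<forall>c\<in>M. a = b [^] (2::nat) \<otimes> c \<longrightarrow> b \<in> Units G)"
  unfolding squarefree_elems_def by (auto simp: Units_submonoid nat_pow_def)

text \<open>The multiplicities determine \<open>s\<close> only up to a unit, which is absorbed into
  the cofactor without leaving \<open>M\<close>. Both returns from a closure property to (i) end
  here.\<close>

lemma squarefree_subD:
  assumes "s \<in> squarefree_elems GM" "b \<in> M" "c \<in> M"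
    and "\<And>p. mlt p s = 2 * mlt p b + mlt p c"
  shows "b \<in> Units G"
proof -
  have s: "s \<in> M" using assms by (simp add: squarefree_sub)
  have "s \<sim> b [^] (2::nat) \<otimes> c"
    using assms s sub_closed by (intro associatedI_mlt) (auto simp: mlt_mult mlt_pow)
  then obtain u where u: "u \<in> Units G" "s = b [^] (2::nat) \<otimes> c \<otimes> u"
    using s assms sub_closed by (meson associatedE_unit m_closed nat_pow_closed)
  then have "s = b [^] (2::nat) \<otimes> (c \<otimes> u)"
    using assms sub_closed Units_closed by (simp add: m_assoc)
  then show ?thesis using assms u Units_in unfolding squarefree_sub by blast
qed

section \<open>Atoms of the submonoid\<close>

text \<open>In \<open>a = b \<otimes> (b \<otimes> c)\<close> one of the two factors is a unit, and
  \<open>b\<close> divides both.\<close>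

lemma atoms_squarefree_sub: "atoms GM \<subseteq> squarefree_elems GM"
proof
  fix a assume a: "a \<in> atoms GM"
  show "a \<in> squarefree_elems GM"
    unfolding squarefree_sub
  proof (intro conjI ballI impI)
    show "a \<in> M" using a by (simp add: atoms_sub)
    fix b c assume bc: "b \<in> M" "c \<in> M" "a = b [^] (2::nat) \<otimes> c"
    then have "a = b \<otimes> (b \<otimes> c)" by (simp add: sub_closed nat_pow_Suc2 numeral_2_eq_2 m_assoc)
    with a bc have "b \<in> Units G \<or> b \<otimes> c \<in> Units G" unfolding atoms_sub by blast
    then show "b \<in> Units G" using bc sub_closed unit_factor by blast
  qed
qed

text \<open>\<open>M\<close> inherits termination from \<open>G\<close>: a proper factorisation in
  \<open>M\<close> lowers the number of primes of \<open>G\<close>.\<close>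

lemma atom_factor:
  assumes "m \<in> M" "m \<notin> Units G"
  obtains a c where "a \<in> atoms GM" "c \<in> M" "m = a \<otimes> c"
proof -
  have "\<exists>a c. a \<in> atoms GM \<and> c \<in> M \<and> m = a \<otimes> c"
    using assms
  proof (induction "size (prime_mset m)" arbitrary: m rule: less_induct)
    case less
    show ?case
    proof (cases "m \<in> atoms GM")
      case True
      then show ?thesis using less sub_closed by (intro exI[of _ m] exI[of _ \<one>]) auto
    next
      case False
      then obtain b c where bc: "b \<in> M" "c \<in> M" "m = b \<otimes> c" "b \<notin> Units G" "c \<notin> Units G"
        using less by (auto simp: atoms_sub)
      then have "size (prime_mset b) < size (prime_mset m)"
        using size_less_mult[of c b] m_comm[of b c] sub_closed by simp
      then obtain a d where ad: "a \<in> atoms GM" "d \<in> M" "b = a \<otimes> d"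
        using less.hyps bc by blast
      then have "m = a \<otimes> (d \<otimes> c)" using bc sub_closed by (auto simp: atoms_sub m_assoc)
      then show ?thesis using ad bc by blast
    qed
  qed
  then show thesis using that by blast
qed

text \<open>
  If a prime of \<open>G\<close> divides two non-associated atoms \<open>x\<close> and \<open>y\<close> of \<open>M\<close>, then \<open>x \<otimes> y\<close> is not
  square-free, so an atom \<open>c\<close> of \<open>M\<close> divides both in \<open>G\<close>, and \<open>(x, c)\<close> is a smaller
  pair of the same kind.
\<close>

lemma non_associated_atoms_sub_coprime:
  assumes sf: "squarefree_elems GM \<subseteq> squarefree_elems G"
    and "x \<in> atoms GM" "y \<in> atoms GM" "\<not> x \<sim> y"
  shows "rel_prime G x y"
  using assms(2-)
proof (induction "size (prime_mset y)" arbitrary: y rule: less_induct)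
  case less
  note [simp] = sub_closed
  have xy: "x \<in> M" "y \<in> M" using less by (auto simp: atoms_sub)
  \<comment> \<open>Atoms of \<open>M\<close> are square-free in \<open>M\<close>, hence in
    \<open>G\<close> by \<open>sf\<close>.\<close>
  have le1: "mlt p x \<le> 1" "mlt p y \<le> 1" for p
    using sf atoms_squarefree_sub less.prems xy squarefree_iff_mlt[of x] squarefree_iff_mlt[of y]
    by auto
  show ?case
  proof (rule ccontr)
    assume "\<not> rel_prime G x y"
    then obtain p where p: "mlt p x > 0" "mlt p y > 0"
      using xy by (auto simp: rel_prime_iff_mlt)
    then have "mlt p x + mlt p y > 1" by linarith
    then have "mlt p (x \<otimes> y) > 1" using xy by (simp add: mlt_mult)
    then have "x \<otimes> y \<notin> squarefree_elems G"
      using xy squarefree_iff_mlt[of "x \<otimes> y"] by (auto simp: not_le)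
    then have "x \<otimes> y \<notin> squarefree_elems GM" using sf by blast
    then obtain b d where bd: "b \<in> M" "d \<in> M" "b \<notin> Units G" "x \<otimes> y = b [^] (2::nat) \<otimes> d"
      using xy by (auto simp: squarefree_sub)
    obtain c e where c: "c \<in> atoms GM" "e \<in> M" "b = c \<otimes> e" using bd atom_factor by blast
    have cM: "c \<in> M" "c \<notin> Units G" using c by (auto simp: atoms_sub)
    define f where "f = e [^] (2::nat) \<otimes> d"
    have f: "f \<in> M" using c bd pow_in by (simp add: f_def)
    have eq: "mlt q x + mlt q y = 2 * mlt q c + mlt q f" for q
    proof -
      have "mlt q x + mlt q y = mlt q (b [^] (2::nat) \<otimes> d)"
        using xy by (simp add: bd(4)[symmetric] mlt_mult)
      also have "\<dots> = 2 * mlt q c + mlt q f"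
        using cM bd(1-2) c by (simp add: f_def mlt_mult mlt_pow)
      finally show ?thesis .
    qed
    \<comment> \<open>The left side of \<open>eq\<close> is at most 2, so \<open>mlt q c\<close> is
      at most 1; if it is 1, then \<open>q\<close> occurs in both \<open>x\<close> and
      \<open>y\<close>.\<close>
    have c_le: "mlt q c \<le> mlt q x" "mlt q c \<le> mlt q y" for q
      using eq[of q] le1[of q] by linarith+
    \<comment> \<open>If \<open>c\<close> were associated to one of the atoms, cancelling it in
      \<open>eq\<close> would make \<open>c\<close> a factor of the other one with a unit cofactor,
      and \<open>x\<close>, \<open>y\<close> would be associated.\<close>
    have not_assoc: "\<not> w \<sim> c" if w: "w = x \<and> z = y \<or> w = y \<and> z = x" for w z
    proof
      assume "w \<sim> c"
      moreover have wz: "w \<in> M" "z \<in> M" "z \<in> atoms GM" using w xy less.prems by auto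
      ultimately have wc: "mlt q w = mlt q c" for q using cM by (simp add: associated_iff_prime_mset)
      have "mlt q z = mlt q (c \<otimes> f)" for q
        using eq[of q] wc[of q] w cM f by (auto simp: mlt_mult)
      then have "z \<sim> c \<otimes> f" using wz cM f by (intro associatedI_mlt) auto
      then obtain u where u: "u \<in> Units G" "z = c \<otimes> f \<otimes> u"
        using wz cM f associatedE_unit[of z "c \<otimes> f"] by auto
      then have z: "z = c \<otimes> (f \<otimes> u)" using cM f by (simp add: m_assoc Units_closed)
      then have "f \<otimes> u \<in> Units G" using wz(3) cM f u Units_in unfolding atoms_sub by blast
      then have "z \<sim> c" using z cM by (intro associatedI2[of "f \<otimes> u"]) simp_all
      then have "mlt q z = mlt q w" for q using wc wz cM by (simp add: associated_iff_prime_mset)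
      then have "x \<sim> y" using w xy by (intro associatedI_mlt) auto
      with less.prems show False by blast
    qed
    \<comment> \<open>Both cases of \<open>not_assoc\<close> enter: \<open>y\<close> against
      \<open>c\<close> makes the decrease strict, \<open>x\<close> against \<open>c\<close> keeps
      the new pair non-associated.\<close>
    have "size (prime_mset c) < size (prime_mset y)"
      using not_assoc[of y x] cM xy c_le associated_sym by (intro size_less_of_mlt_le) auto
    then have "rel_prime G x c" using less.hyps c less.prems not_assoc[of x y] by blast
    moreover obtain q where "mlt q c > 0" using cM non_unit_mlt[of c] by auto
    moreover have "mlt q x > 0" using c_le(1)[of q] \<open>mlt q c > 0\<close> by linarith
    ultimately show False using cM xy rel_prime_iff_mlt[of x c] by (metis sub_closed less_irrefl)
  qed
qed

text \<open>An atom split off from \<open>m\<close> either contains \<open>p\<close> or leaves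
  \<open>p\<close> in the smaller cofactor.\<close>

lemma atom_over_prime:
  assumes "m \<in> M" "mlt p m > 0"
  obtains a c where "a \<in> atoms GM" "c \<in> M" "m = a \<otimes> c" "mlt p a > 0"
proof -
  have "\<exists>a c. a \<in> atoms GM \<and> c \<in> M \<and> m = a \<otimes> c \<and> mlt p a > 0"
    using assms
  proof (induction "size (prime_mset m)" arbitrary: m rule: less_induct)
    case less
    note [simp] = sub_closed
    have "m \<notin> Units G" using less.prems prime_mset_eq_empty_iff[of m] by auto
    then obtain a c where ac: "a \<in> atoms GM" "c \<in> M" "m = a \<otimes> c"
      using less.prems atom_factor by blast
    then have a: "a \<in> M" "a \<notin> Units G" by (auto simp: atoms_sub)
    show ?case
    proof (cases "mlt p a > 0")
      case True
      then show ?thesis using ac by blast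
    next
      case False
      then have "mlt p c > 0" using less.prems ac a by (simp add: mlt_mult)
      moreover have "size (prime_mset c) < size (prime_mset m)"
        using ac a size_less_mult by simp
      ultimately obtain b d where bd: "b \<in> atoms GM" "d \<in> M" "c = b \<otimes> d" "mlt p b > 0"
        using less.hyps ac by blast
      then have "m = b \<otimes> (a \<otimes> d)" using ac a by (auto simp: atoms_sub m_lcomm)
      then show ?thesis using bd a by blast
    qed
  qed
  then show thesis using that by blast
qed

lemma rel_prime_sub:
  "rel_prime GM a b \<longleftrightarrow>
    \<not> (\<exists>d\<in>M. d \<notin> Units G \<and> (\<exists>x\<in>M. a = d \<otimes> x) \<and> (\<exists>y\<in>M. b = d \<otimes> y))"
  by (auto simp: rel_prime_def factor_def Units_submonoid)

text \<open>A common prime of \<open>a\<close> and \<open>b\<close> lies in an atom of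
  \<open>M\<close> dividing \<open>a\<close> and in one dividing \<open>b\<close>. By
  \<open>coprime\<close> these atoms are associated, so one of them is a common divisor in
  \<open>M\<close>.\<close>

lemma rel_prime_of_rel_prime_sub:
  assumes coprime: "\<And>x y. x \<in> atoms GM \<Longrightarrow> y \<in> atoms GM \<Longrightarrow> \<not> x \<sim> y \<Longrightarrow> rel_prime G x y"
    and ab: "a \<in> M" "b \<in> M" "rel_prime GM a b"
  shows "rel_prime G a b"
proof (rule ccontr)
  note [simp] = sub_closed
  assume "\<not> ?thesis"
  then obtain p where p: "mlt p a > 0" "mlt p b > 0" using ab by (auto simp: rel_prime_iff_mlt)
  obtain x c where x: "x \<in> atoms GM" "c \<in> M" "a = x \<otimes> c" "mlt p x > 0"
    using atom_over_prime ab p by blast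
  obtain y d where y: "y \<in> atoms GM" "d \<in> M" "b = y \<otimes> d" "mlt p y > 0"
    using atom_over_prime ab p by blast
  have xy: "x \<in> M" "x \<notin> Units G" "y \<in> M" using x y by (auto simp: atoms_sub)
  have "\<not> rel_prime G x y"
    using rel_prime_iff_mlt[OF sub_closed[OF xy(1)] sub_closed[OF xy(3)]] x(4) y(4)
    by (metis less_irrefl)
  then have "y \<sim> x" using coprime x y xy associated_sym by blast
  then obtain u where u: "u \<in> Units G" "y = x \<otimes> u"
    by (rule associatedE_unit[OF _ sub_closed[OF xy(3)] sub_closed[OF xy(1)]])
  have "b = x \<otimes> (u \<otimes> d)"
    unfolding y(3) u(2) using u(1) y(2) xy(1) by (simp add: m_assoc Units_closed)
  moreover have "u \<otimes> d \<in> M" using u(1) y(2) Units_in by simp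
  ultimately have "\<exists>d\<in>M. d \<notin> Units G \<and> (\<exists>x\<in>M. a = d \<otimes> x) \<and> (\<exists>y\<in>M. b = d \<otimes> y)"
    using x(2,3) xy(1,2) by metis
  then show False by (rule notE[OF ab(3)[unfolded rel_prime_sub]])
qed

text \<open>A common non-unit divisor in \<open>M\<close> has unit cofactors in both atoms, so it is
  associated to each. This reduces (iii) to (ii).\<close>

lemma non_associated_atoms_rel_prime_sub:
  assumes "x \<in> atoms GM" "y \<in> atoms GM" "\<not> x \<sim> y"
  shows "rel_prime GM x y"
  unfolding rel_prime_sub
proof
  note [simp] = sub_closed
  assume "\<exists>d\<in>M. d \<notin> Units G \<and> (\<exists>a\<in>M. x = d \<otimes> a) \<and> (\<exists>b\<in>M. y = d \<otimes> b)"
  then obtain d a b where d: "d \<in> M" "d \<notin> Units G" "a \<in> M" "x = d \<otimes> a" "b \<in> M" "y = d \<otimes> b"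
    by blast
  then have "a \<in> Units G" "b \<in> Units G" using assms unfolding atoms_sub by blast+
  then have "x \<sim> d" "y \<sim> d"
    using associatedI2[of a x d] associatedI2[of b y d] d(1,4,6) sub_closed by blast+
  then have "x \<sim> y" using d by (simp add: associated_iff_prime_mset)
  with assms show False by blast
qed

section \<open>The free basis formed by the atoms\<close>

text \<open>\<open>B\<close> picks one atom from each association class. Splitting off atoms gives
  existence of the representation; coprimality lets each exponent be read off at a single prime,
  which gives uniqueness.\<close>

lemma free_of_coprime_atoms:
  assumes sf: "atoms GM \<subseteq> squarefree_elems G"
    and coprime: "\<And>x y. x \<in> atoms GM \<Longrightarrow> y \<in> atoms GM \<Longrightarrow> \<not> x \<sim> y \<Longrightarrow> rel_prime G x y"
  shows "\<exists>B. B \<subseteq> squarefree_elems G - Units G \<and> pairwise (rel_prime G) B \<and> units_times_free G M B"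
proof -
  note [simp] = sub_closed
  define rep where "rep a = (SOME b. b \<in> atoms GM \<and> b \<sim> a)" for a
  have rep: "rep a \<in> atoms GM \<and> rep a \<sim> a" if "a \<in> atoms GM" for a
    unfolding rep_def using that by (metis (mono_tags, lifting) associated_refl atoms_sub someI sub_closed)
  have rep_mset: "prime_mset (rep a) = prime_mset a" if "a \<in> atoms GM" for a
    using that rep[OF that] by (auto simp: atoms_sub associated_iff_prime_mset)
  \<comment> \<open>The choice in \<open>rep\<close> depends only on the association class, so
    distinct elements of \<open>B\<close> are non-associated.\<close>
  have rep_eq: "rep a = rep b" if ab: "a \<in> atoms GM" "b \<in> atoms GM" "rep a \<sim> rep b" for a b
  proof -
    have "rep a \<in> M" "rep b \<in> M" using ab rep by (auto simp: atoms_sub)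
    then have "prime_mset a = prime_mset b"
      using ab rep_mset by (simp add: associated_iff_prime_mset)
    then have "c \<sim> a \<longleftrightarrow> c \<sim> b" if "c \<in> atoms GM" for c
      using that ab by (auto simp: atoms_sub associated_iff_prime_mset)
    then show ?thesis unfolding rep_def by metis
  qed
  define B where "B = rep ` atoms GM"
  have B_atoms: "B \<subseteq> atoms GM" using rep by (auto simp: B_def)
  then have BM: "b \<in> M" "b \<notin> Units G" if "b \<in> B" for b using that by (auto simp: atoms_sub)
  have B_coprime: "rel_prime G b c" if "b \<in> B" "c \<in> B" "b \<noteq> c" for b c
  proof -
    have "\<not> b \<sim> c" using that rep_eq by (auto simp: B_def)
    then show ?thesis using that B_atoms coprime by blast
  qed
  let ?supp = "\<lambda>k :: 'a \<Rightarrow> nat. {b. k b \<noteq> 0}"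
  let ?prod = "\<lambda>k :: 'a \<Rightarrow> nat. \<Otimes>b\<in>?supp k. b [^] k b"
  let ?K = "{k. finite (?supp k) \<and> ?supp k \<subseteq> B}"
  have prod_in: "?prod k \<in> M" if "k \<in> ?K" for k
    using that BM by (intro finprod_pow_in) auto
  have mlt_prod: "mlt p (?prod k) = (\<Sum>b\<in>?supp k. k b * mlt p b)" if "k \<in> ?K" for p k
    using that BM by (intro mlt_finprod_pow) auto
  \<comment> \<open>Existence is first shown on multiplicities; the unit is recovered only when
    surjectivity is proved.\<close>
  have ex: "\<exists>k\<in>?K. \<forall>p. mlt p m = (\<Sum>b\<in>?supp k. k b * mlt p b)" if "m \<in> M" for m
    using that
  proof (induction "size (prime_mset m)" arbitrary: m rule: less_induct)
    case less
    show ?case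
    proof (cases "m \<in> Units G")
      case True
      then show ?thesis
        using less.prems prime_mset_eq_empty_iff[of m] by (intro bexI[of _ "\<lambda>_. 0"]) auto
    next
      case False
      then obtain a c where ac: "a \<in> atoms GM" "c \<in> M" "m = a \<otimes> c"
        using less.prems atom_factor by blast
      then have a: "a \<in> M" "a \<notin> Units G" by (auto simp: atoms_sub)
      have "size (prime_mset c) < size (prime_mset m)" using ac a size_less_mult by simp
      from less.hyps[OF this ac(2)] obtain k
        where k: "k \<in> ?K" "\<forall>p. mlt p c = (\<Sum>b\<in>?supp k. k b * mlt p b)"
        by (rule bexE)
      define b where "b = rep a"
      have b: "b \<in> B" "prime_mset a = prime_mset b"
        using ac(1) rep_mset by (simp_all add: B_def b_def)
      define k' where "k' = k(b := Suc (k b))"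
      have supp: "?supp k' = insert b (?supp k)" by (auto simp: k'_def)
      show ?thesis
      proof (intro bexI[of _ k'] allI)
        show "k' \<in> ?K" unfolding mem_Collect_eq supp using k(1) b(1) by auto
        fix p
        \<comment> \<open>\<open>b\<close> may lie outside the support of \<open>k\<close>; summing
          over \<open>insert b (?supp k)\<close> covers both cases.\<close>
        have "(\<Sum>x\<in>?supp k'. k' x * mlt p x)
            = (\<Sum>x\<in>insert b (?supp k). k x * mlt p x + (if x = b then mlt p b else 0))"
          unfolding supp by (intro sum.cong) (auto simp: k'_def)
        also have "\<dots> = (\<Sum>x\<in>insert b (?supp k). k x * mlt p x) + mlt p b"
          using k by (simp add: sum.distrib)
        also have "(\<Sum>x\<in>insert b (?supp k). k x * mlt p x) = (\<Sum>x\<in>?supp k. k x * mlt p x)"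
          using k by (intro sum.mono_neutral_right) auto
        finally show "mlt p m = (\<Sum>x\<in>?supp k'. k' x * mlt p x)"
          using ac a k b by (simp add: mlt_mult)
      qed
    qed
  qed
  have "units_times_free G M B"
    unfolding units_times_free_def bij_betw_def
  proof
    show "inj_on (\<lambda>(u, k). u \<otimes> ?prod k) (Units G \<times> ?K)"
    proof (rule inj_onI, clarify)
      fix u v k l
      assume u: "u \<in> Units G" and v: "v \<in> Units G"
        and fk: "finite (?supp k)" "?supp k \<subseteq> B" and fl: "finite (?supp l)" "?supp l \<subseteq> B"
        and eq: "u \<otimes> ?prod k = v \<otimes> ?prod l"
      have kK: "k \<in> ?K" and lK: "l \<in> ?K" using fk fl by auto
      have "mlt p (?prod k) = mlt p (u \<otimes> ?prod k)" "mlt p (?prod l) = mlt p (v \<otimes> ?prod l)" for p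
        using u v prod_in[OF kK] prod_in[OF lK] mlt_unit_mult by (metis sub_closed)+
      then have mlt_eq: "mlt p (?prod k) = mlt p (?prod l)" for p unfolding eq by metis
      have "k b = l b" for b
      proof (cases "b \<in> B")
        case True
        then obtain p where p: "mlt p b > 0" using BM non_unit_mlt by (meson sub_closed)
        \<comment> \<open>The exponent at \<open>b\<close> is determined by the multiplicity at a
          prime of \<open>b\<close>. Inserting \<open>b\<close> into the support allows
          \<open>j b = 0\<close>.\<close>
        have ext: "mlt p (?prod j) = j b * mlt p b" if j: "j \<in> ?K" for j
        proof -
          have "mlt p (?prod j) = (\<Sum>x\<in>insert b (?supp j). j x * mlt p x)"
            unfolding mlt_prod[OF j] using j by (intro sum.mono_neutral_left) auto
          also have "\<dots> = j b * mlt p b"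
          proof (rule sum_mlt_pairwise_coprime)
            have sub: "insert b (?supp j) \<subseteq> B" using j True by blast
            show "x \<in> carrier G" if "x \<in> insert b (?supp j)" for x
              using that sub BM sub_closed by blast
            show "rel_prime G x b" if "x \<in> insert b (?supp j)" "x \<noteq> b" for x
              using that sub True B_coprime by blast
          qed (use j p in auto)
          finally show ?thesis .
        qed
        show ?thesis using mlt_eq[of p] ext[OF kK] ext[OF lK] p by simp
      next
        case False
        then have "k b = 0" "l b = 0" using fk fl by auto
        then show ?thesis by simp
      qed
      then have "k = l" by blast
      then show "u = v \<and> k = l"
        using eq r_cancel[of u "?prod k" v] u v prod_in[OF kK] Units_closed sub_closed by blast
    qed
    show "(\<lambda>(u, k). u \<otimes> ?prod k) ` (Units G \<times> ?K) = M"
    proof (rule equalityI; rule subsetI)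
      fix m assume "m \<in> (\<lambda>(u, k). u \<otimes> ?prod k) ` (Units G \<times> ?K)"
      then show "m \<in> M"
      proof (elim imageE SigmaE)
        fix z u k assume "m = (\<lambda>(u, k). u \<otimes> ?prod k) z" "z = (u, k)" "u \<in> Units G" "k \<in> ?K"
        then show "m \<in> M" using M.m_closed[OF Units_in prod_in] by (simp only: prod.case)
      qed
    next
      fix m assume m: "m \<in> M"
      from ex[OF m] obtain k where k: "k \<in> ?K" "\<forall>p. mlt p m = (\<Sum>b\<in>?supp k. k b * mlt p b)"
        by (rule bexE)
      have "m \<sim> ?prod k"
      proof (rule associatedI_mlt)
        show "mlt p m = mlt p (?prod k)" for p unfolding mlt_prod[OF k(1)] using k(2) by blast
      qed (rule sub_closed[OF m], rule sub_closed[OF prod_in[OF k(1)]])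
      then obtain u where "u \<in> Units G" "m = ?prod k \<otimes> u"
        by (rule associatedE_unit[OF _ sub_closed[OF m] sub_closed[OF prod_in[OF k(1)]]])
      then have "m = u \<otimes> ?prod k"
        using m_comm[OF sub_closed[OF prod_in[OF k(1)]] Units_closed[of u]] by (simp only:)
      then have "m = (\<lambda>(u, k). u \<otimes> ?prod k) (u, k)" by (simp only: prod.case)
      then show "m \<in> (\<lambda>(u, k). u \<otimes> ?prod k) ` (Units G \<times> ?K)"
        by (rule image_eqI) (rule SigmaI[OF \<open>u \<in> Units G\<close> k(1)])
    qed
  qed
  moreover have "B \<subseteq> squarefree_elems G - Units G" using B_atoms BM sf by blast
  moreover have "pairwise (rel_prime G) B" using B_coprime by (auto simp: pairwise_def)
  ultimately show ?thesis by blast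
qed

section \<open>From the basis to the closure properties\<close>

text \<open>The witness replaces each exponent \<open>k b\<close> by \<open>g (k b)\<close>. A prime
  occurs in at most one basis element, and there with multiplicity 1, so \<open>k b\<close> and
  \<open>g (k b)\<close> are the multiplicities in \<open>m\<close> and in the witness.\<close>

lemma transform_mlt_in_free:
  assumes B: "B \<subseteq> squarefree_elems G - Units G" "pairwise (rel_prime G) B" "units_times_free G M B"
    and m: "m \<in> M" and g: "g 0 = (0::nat)"
  obtains t where "t \<in> M" "\<And>p. mlt p t = g (mlt p m)"
proof -
  note [simp] = sub_closed
  let ?supp = "\<lambda>k :: 'a \<Rightarrow> nat. {b. k b \<noteq> 0}"
  let ?prod = "\<lambda>k :: 'a \<Rightarrow> nat. \<Otimes>b\<in>?supp k. b [^] k b"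
  let ?K = "{k. finite (?supp k) \<and> ?supp k \<subseteq> B}"
  have img: "(\<lambda>(u, k). u \<otimes> ?prod k) ` (Units G \<times> ?K) = M"
    using B(3) by (simp add: units_times_free_def bij_betw_def)
  have BG: "b \<in> carrier G" if "b \<in> B" for b using that B(1) by (auto simp: squarefree_elems_def)
  have BM: "b \<in> M" if "b \<in> B" for b
  proof -
    \<comment> \<open>Unit part 1 and exponent 1 at \<open>b\<close> alone represent
      \<open>b\<close>, so the basis lies in \<open>M\<close>.\<close>
    define k :: "'a \<Rightarrow> nat" where "k = (\<lambda>x. if x = b then 1 else 0)"
    have "?supp k = {b}" by (auto simp: k_def)
    then have "b = (\<lambda>(u, k). u \<otimes> ?prod k) (\<one>, k)" "(\<one>, k) \<in> Units G \<times> ?K"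
      using that BG by (auto simp: k_def)
    then show ?thesis using img by blast
  qed
  obtain u k where uk: "u \<in> Units G" "finite (?supp k)" "?supp k \<subseteq> B" "m = u \<otimes> ?prod k"
  proof -
    from m have "m \<in> (\<lambda>(u, k). u \<otimes> ?prod k) ` (Units G \<times> ?K)" unfolding img .
    then obtain z where z: "m = (\<lambda>(u, k). u \<otimes> ?prod k) z" "z \<in> Units G \<times> ?K" by (rule imageE)
    from z(2) obtain u k where "u \<in> Units G" "k \<in> ?K" "z = (u, k)" by (rule SigmaE)
    with z(1) show thesis using that[of u k] by (simp only: prod.case mem_Collect_eq)
  qed
  have sub: "b \<in> carrier G" if "b \<in> ?supp k" for b using that uk BG by blast
  have prod: "?prod k \<in> carrier G" using sub by (intro finprod_closed) auto
  have u: "prime_mset u = {#}" using uk prime_mset_eq_empty_iff Units_closed by blast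
  have mlt_m: "mlt p m = (\<Sum>b\<in>?supp k. k b * mlt p b)" for p
  proof -
    have "mlt p m = mlt p (?prod k)"
      unfolding uk(4) using uk(1) prod u by (subst mlt_mult) auto
    also have "\<dots> = (\<Sum>b\<in>?supp k. k b * mlt p b)"
      using uk(2) sub by (rule mlt_finprod_pow)
    finally show ?thesis .
  qed
  define t where "t = (\<Otimes>b\<in>?supp k. b [^] g (k b))"
  have "t \<in> M" unfolding t_def using uk BM by (intro finprod_pow_in) auto
  moreover have "mlt p t = g (mlt p m)" for p
  \<comment> \<open>A prime in no basis element of the support has multiplicity 0 in
    \<open>m\<close> and \<open>t\<close>, which fits because \<open>g 0 = 0\<close>.\<close>
  proof (cases "\<exists>b\<in>?supp k. mlt p b > 0")
    case True
    then obtain b where b: "b \<in> ?supp k" "mlt p b > 0" by blast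
    have "b \<in> squarefree_elems G" using b uk B by blast
    then have "mlt p b \<le> 1" using squarefree_iff_mlt[of b] sub[OF b(1)] by blast
    then have b1: "mlt p b = 1" using b by linarith
    have "(\<Sum>x\<in>?supp k. j x * mlt p x) = j b * mlt p b" for j
      using uk(2) sub b
    proof (rule sum_mlt_pairwise_coprime)
      show "rel_prime G x b" if "x \<in> ?supp k" "x \<noteq> b" for x
        using that b uk(3) B(2) unfolding pairwise_def by blast
    qed
    then have "(\<Sum>x\<in>?supp k. j x * mlt p x) = j b" for j using b1 by simp
    moreover have "mlt p t = (\<Sum>x\<in>?supp k. g (k x) * mlt p x)"
      unfolding t_def using uk sub by (intro mlt_finprod_pow) auto
    ultimately show ?thesis by (simp add: mlt_m)
  next
    case False
    then have z: "mlt p b = 0" if "b \<in> ?supp k" for b using that by (metis gr0I)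
    have "mlt p t = (\<Sum>b\<in>?supp k. g (k b) * mlt p b)"
      unfolding t_def using uk sub by (intro mlt_finprod_pow) auto
    then have "mlt p t = 0" using z by (simp add: sum.neutral)
    moreover have "mlt p m = 0" using z by (simp add: mlt_m)
    ultimately show ?thesis using g by simp
  qed
  ultimately show thesis using that by blast
qed

text \<open>Since \<open>mlt p b \<le> 1\<close>, dividing \<open>2 * mlt p a + mlt p b\<close> by 2
  gives quotient \<open>mlt p a\<close> and remainder \<open>mlt p b\<close>.\<close>

lemma square_mult_in_of_free:
  assumes B: "B \<subseteq> squarefree_elems G - Units G" "pairwise (rel_prime G) B" "units_times_free G M B"
    and a: "a \<in> carrier G" and b: "b \<in> squarefree_elems G" and m: "a [^] (2::nat) \<otimes> b \<in> M"
  shows "a \<in> M \<and> b \<in> M"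
proof -
  have bG: "b \<in> carrier G" using b by (simp add: squarefree_elems_def)
  have b1: "mlt p b \<le> 1" for p using b bG squarefree_iff_mlt by blast
  have eq: "mlt p (a [^] (2::nat) \<otimes> b) = 2 * mlt p a + mlt p b" for p
    using a bG by (simp add: mlt_mult mlt_pow)
  obtain c where c: "c \<in> M" "\<And>p. mlt p c = mlt p (a [^] (2::nat) \<otimes> b) div 2"
    using transform_mlt_in_free[OF B m, of "\<lambda>x. x div 2"] by auto
  obtain d where d: "d \<in> M" "\<And>p. mlt p d = mlt p (a [^] (2::nat) \<otimes> b) mod 2"
    using transform_mlt_in_free[OF B m, of "\<lambda>x. x mod 2"] by auto
  have "mlt p a = mlt p c" "mlt p b = mlt p d" for p
    unfolding c(2) d(2) eq using b1[of p] by presburger+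
  then show ?thesis using in_cong[OF c(1) a] in_cong[OF d(1) bG] by blast
qed

text \<open>The primes of \<open>s i\<close> are exactly those with multiplicity \<open>i\<close> in
  the product, so the indicator of \<open>i\<close> recovers \<open>s i\<close> up to a unit. The
  indicator vanishes at 0 because \<open>i \<ge> 1\<close>.\<close>

lemma coprime_powers_in_of_free:
  fixes n :: nat and s :: "nat \<Rightarrow> 'a"
  assumes B: "B \<subseteq> squarefree_elems G - Units G" "pairwise (rel_prime G) B" "units_times_free G M B"
    and s: "\<And>i. i \<in> {1..n} \<Longrightarrow> s i \<in> squarefree_elems G"
    and coprime: "\<And>i j. i \<in> {1..n} \<Longrightarrow> j \<in> {1..n} \<Longrightarrow> i \<noteq> j \<Longrightarrow> rel_prime G (s i) (s j)"
    and m: "(\<Otimes>i\<in>{1..n}. s i [^] i) \<in> M" and i: "i \<in> {1..n}"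
  shows "s i \<in> M"
proof -
  let ?m = "\<Otimes>i\<in>{1..n}. s i [^] i"
  have sG: "s j \<in> carrier G" if "j \<in> {1..n}" for j using s[OF that] by (simp add: squarefree_elems_def)
  have s1: "mlt p (s j) \<le> 1" if "j \<in> {1..n}" for p j
    using s[OF that] sG[OF that] squarefree_iff_mlt by blast
  have mlt_m: "mlt p ?m = (\<Sum>j\<in>{1..n}. j * mlt p (s j))" for p
    using sG by (intro mlt_finprod_pow) auto
  have m_pos: "mlt p ?m = j" if "j \<in> {1..n}" "mlt p (s j) > 0" for p j
  proof -
    have "(\<Sum>j\<in>{1..n}. j * mlt p (s j)) = j * mlt p (s j)"
      using sG that coprime by (intro sum_mlt_pairwise_coprime) auto
    moreover have "mlt p (s j) = 1" using s1[OF that(1), of p] that(2) by linarith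
    ultimately show ?thesis unfolding mlt_m by simp
  qed
  obtain t where t: "t \<in> M" "\<And>p. mlt p t = (if mlt p ?m = i then 1 else 0)"
    using transform_mlt_in_free[OF B m, of "\<lambda>x. if x = i then 1 else 0"] i by auto
  have "mlt p (s i) = mlt p t" for p
  proof (cases "mlt p (s i) > 0")
    case True
    then have "mlt p (s i) = 1" using s1[OF i, of p] by linarith
    then show ?thesis using m_pos[OF i True] t(2)[of p] by (simp only: if_True simp_thms)
  next
    case False
    have "mlt p ?m \<noteq> i"
    proof
      assume eq: "mlt p ?m = i"
      have "i \<noteq> 0" using i by simp
      then have "(\<Sum>j\<in>{1..n}. j * mlt p (s j)) \<noteq> 0" unfolding mlt_m[symmetric] eq .
      then obtain j where "j \<in> {1..n}" "j * mlt p (s j) \<noteq> 0" by (meson sum.neutral)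
      then show False using m_pos[of j p] eq False by simp
    qed
    moreover have "mlt p (s i) = 0" using False by linarith
    ultimately show ?thesis unfolding t(2) by (simp only: if_False)
  qed
  then show ?thesis using in_cong[OF t(1) sG[OF i]] by blast
qed

text \<open>Horner scheme: up to a unit the product is \<open>a [^] 2 \<otimes> s 0\<close>, where
  \<open>a\<close> is the same product for the shifted sequence. The hypothesis \<open>sq\<close>
  splits off \<open>s 0\<close>, and the induction treats \<open>a\<close>.\<close>

lemma binary_powers_in_of_square_mult_in:
  assumes sq: "\<And>a b. a \<in> carrier G \<Longrightarrow> b \<in> squarefree_elems G \<Longrightarrow> a [^] (2::nat) \<otimes> b \<in> M \<Longrightarrow> a \<in> M \<and> b \<in> M"
    and s: "\<And>i. i \<le> n \<Longrightarrow> s i \<in> squarefree_elems G"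
    and m: "(\<Otimes>i\<in>{..n}. s i [^] ((2::nat) ^ i)) \<in> M" and i: "i \<le> n"
  shows "s i \<in> M"
  using s m i
proof (induction n arbitrary: s i)
  case 0
  then have "s 0 \<in> carrier G" by (simp add: squarefree_elems_def)
  then show ?case using 0 by simp
next
  case (Suc n)
  have sG: "s j \<in> carrier G" if "j \<le> Suc n" for j
    using Suc.prems(1)[OF that] by (simp add: squarefree_elems_def)
  define a where "a = (\<Otimes>j\<in>{..n}. s (Suc j) [^] ((2::nat) ^ j))"
  have a: "a \<in> carrier G" unfolding a_def using sG by (intro finprod_closed) auto
  have "a [^] (2::nat) \<otimes> s 0 \<in> M"
  proof (rule in_cong[OF Suc.prems(2)])
    fix p
    have "mlt p (\<Otimes>j\<in>{..Suc n}. s j [^] ((2::nat) ^ j)) = (\<Sum>j\<in>{..Suc n}. 2 ^ j * mlt p (s j))"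
      using sG by (intro mlt_finprod_pow) auto
    also have "\<dots> = mlt p (s 0) + 2 * (\<Sum>j\<in>{..n}. 2 ^ j * mlt p (s (Suc j)))"
      by (subst sum.atMost_Suc_shift) (simp add: sum_distrib_left mult.assoc)
    also have "(\<Sum>j\<in>{..n}. 2 ^ j * mlt p (s (Suc j))) = mlt p a"
      unfolding a_def using sG by (intro mlt_finprod_pow[symmetric]) auto
    finally show "mlt p (a [^] (2::nat) \<otimes> s 0) = mlt p (\<Otimes>j\<in>{..Suc n}. s j [^] ((2::nat) ^ j))"
      using a sG by (simp add: mlt_mult mlt_pow)
  qed (use a sG in simp)
  then have *: "a \<in> M" "s 0 \<in> M" using sq[OF a Suc.prems(1)] by auto
  show ?case
  proof (cases i)
    case (Suc j)
    then show ?thesis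
      using Suc.IH[of "\<lambda>j. s (Suc j)" j] Suc.prems *(1) unfolding a_def by auto
  qed (use * in simp)
qed

text \<open>\<open>bin\<close> is (vii). Grouping the factors by digit position writes the given
  element, up to a unit, as the product of the \<open>s i [^] 2 ^ i\<close>; on multiplicities this
  exchanges two sums. Each \<open>s i\<close> is square-free because the atoms are pairwise coprime
  and the digits are 0 or 1.\<close>

lemma binary_digits_in_of_binary_powers_in:
  fixes n :: nat
  assumes bin: "\<And>n s i. (\<And>i. i \<le> n \<Longrightarrow> s i \<in> squarefree_elems G) \<Longrightarrow>
      (\<Otimes>i\<in>{..n}. s i [^] ((2::nat) ^ i)) \<in> M \<Longrightarrow> i \<le> n \<Longrightarrow> s i \<in> M"
    and q: "\<And>j. j \<in> {1..n} \<Longrightarrow> q j \<in> atoms G"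
    and na: "\<And>i j. i \<in> {1..n} \<Longrightarrow> j \<in> {1..n} \<Longrightarrow> i \<noteq> j \<Longrightarrow> \<not> q i \<sim> q j"
    and m: "(\<Otimes>j\<in>{1..n}. q j [^] k j) \<in> M"
    and c: "\<And>i j. i \<le> r \<Longrightarrow> j \<in> {1..n} \<Longrightarrow> c i j \<in> {0, 1 :: nat}"
    and k: "\<And>j. j \<in> {1..n} \<Longrightarrow> k j = (\<Sum>i\<le>r. c i j * 2 ^ i)"
    and i: "i \<le> r"
  shows "(\<Otimes>j\<in>{1..n}. q j [^] c i j) \<in> M"
proof -
  define s where "s i = (\<Otimes>j\<in>{1..n}. q j [^] c i j)" for i
  have qG: "q j \<in> carrier G" if "j \<in> {1..n}" for j using q[OF that] by (simp add: atoms_def)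
  have mlt_s: "mlt p (s i) = (\<Sum>j\<in>{1..n}. c i j * mlt p (q j))" for p i
    unfolding s_def using qG by (intro mlt_finprod_pow) auto
  have sG: "s i \<in> carrier G" for i unfolding s_def using qG by (intro finprod_closed) auto
  have "s i \<in> M"
  proof (rule bin[OF _ _ i])
    fix i assume i: "i \<le> r"
    have "mlt p (s i) \<le> 1" for p
    proof (cases "\<exists>j\<in>{1..n}. mlt p (q j) > 0")
      case True
      then obtain j where j: "j \<in> {1..n}" "mlt p (q j) > 0" by blast
      have "mlt p (s i) = c i j * mlt p (q j)"
        unfolding mlt_s using qG j q na
        by (intro sum_mlt_pairwise_coprime non_associated_atoms_coprime) auto
      moreover have "mlt p (q j) \<le> 1"
        using q[OF j(1)] qG[OF j(1)] atom_iff_prime_mset[of "q j"] by auto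
      ultimately show ?thesis using c[OF i j(1)] by auto
    next
      case False
      then have "mlt p (s i) = 0" unfolding mlt_s by (intro sum.neutral) auto
      then show ?thesis by simp
    qed
    then show "s i \<in> squarefree_elems G" using squarefree_iff_mlt[OF sG] by blast
  next
    show "(\<Otimes>i\<in>{..r}. s i [^] ((2::nat) ^ i)) \<in> M"
    proof (rule in_cong[OF m])
      fix p
      have "mlt p (\<Otimes>i\<in>{..r}. s i [^] ((2::nat) ^ i)) = (\<Sum>i\<le>r. 2 ^ i * mlt p (s i))"
        using sG by (intro mlt_finprod_pow) auto
      also have "\<dots> = (\<Sum>i\<le>r. \<Sum>j\<in>{1..n}. c i j * 2 ^ i * mlt p (q j))"
        by (simp add: mlt_s sum_distrib_left mult_ac)
      also have "\<dots> = (\<Sum>j\<in>{1..n}. \<Sum>i\<le>r. c i j * 2 ^ i * mlt p (q j))"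
        by (rule sum.swap)
      also have "\<dots> = (\<Sum>j\<in>{1..n}. k j * mlt p (q j))"
        using k by (intro sum.cong) (simp_all add: sum_distrib_right)
      also have "\<dots> = mlt p (\<Otimes>j\<in>{1..n}. q j [^] k j)"
        using qG by (intro mlt_finprod_pow[symmetric]) auto
      finally show "mlt p (\<Otimes>i\<in>{..r}. s i [^] ((2::nat) ^ i)) = mlt p (\<Otimes>j\<in>{1..n}. q j [^] k j)" .
    qed (use sG in \<open>intro finprod_closed, auto\<close>)
  qed
  then show ?thesis by (simp add: s_def)
qed

section \<open>From the closure properties back to square-freeness\<close>

text \<open>\<open>dig\<close> is (vi) and puts the digit products \<open>d i\<close> of
  \<open>s\<close> into \<open>M\<close>. Up to a unit, \<open>s\<close> is \<open>d 0\<close> times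
  the square of some \<open>w\<close> in \<open>M\<close>; then \<open>w\<close> is a unit, and the
  multiplicities of \<open>d 0\<close> are single digits.\<close>

lemma squarefree_of_binary_digits_in:
  assumes dig: "\<And>(n::nat) k q r c i. n \<ge> 1 \<Longrightarrow> (\<And>j. j \<in> {1..n} \<Longrightarrow> q j \<in> atoms G) \<Longrightarrow>
      (\<And>i j. i \<in> {1..n} \<Longrightarrow> j \<in> {1..n} \<Longrightarrow> i \<noteq> j \<Longrightarrow> \<not> q i \<sim> q j) \<Longrightarrow>
      (\<Otimes>j\<in>{1..n}. q j [^] k j) \<in> M \<Longrightarrow>
      (\<And>i j. i \<le> r \<Longrightarrow> j \<in> {1..n} \<Longrightarrow> c i j \<in> {0, 1 :: nat}) \<Longrightarrow>
      (\<And>j. j \<in> {1..n} \<Longrightarrow> k j = (\<Sum>i\<le>r. c i j * 2 ^ i)) \<Longrightarrow>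
      i \<le> (r::nat) \<Longrightarrow> (\<Otimes>j\<in>{1..n}. q j [^] c i j) \<in> M"
    and s: "s \<in> squarefree_elems GM"
  shows "s \<in> squarefree_elems G"
proof -
  have sM: "s \<in> M" using s by (simp add: squarefree_sub)
  then have sG: "s \<in> carrier G" by (rule sub_closed)
  show ?thesis
  proof (rule atom_enumeration[OF sG])
    fix n :: nat and q :: "nat \<Rightarrow> 'a" and k :: "nat \<Rightarrow> nat"
    assume q: "\<And>j. j \<in> {1..n} \<Longrightarrow> q j \<in> atoms G"
      and na: "\<And>i j. i \<in> {1..n} \<Longrightarrow> j \<in> {1..n} \<Longrightarrow> i \<noteq> j \<Longrightarrow> \<not> q i \<sim> q j"
      and k: "\<And>j. j \<in> {1..n} \<Longrightarrow> k j \<le> size (prime_mset s)"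
      and mlt_q: "\<And>g p. g 0 = 0 \<Longrightarrow> mlt p (\<Otimes>j\<in>{1..n}. q j [^] (g (k j) :: nat)) = g (mlt p s)"
    have qG: "q j \<in> carrier G" if "j \<in> {1..n}" for j using q[OF that] by (simp add: atoms_def)
    \<comment> \<open>The number of prime factors bounds every exponent, so \<open>r + 1\<close>
      binary digits suffice for all of them.\<close>
    define r where "r = size (prime_mset s)"
    have less: "x < 2 ^ Suc r" if "x \<le> r" for x
      using le_less_trans[OF that less_exp[of r]] by simp
    have digits: "(\<Sum>i\<le>r. (x div 2 ^ i mod 2) * 2 ^ i) = x" if "x \<le> r" for x
      using sum_binary_digits[OF less[OF that]] by (simp add: lessThan_Suc_atMost)
    define d where "d i = (\<Otimes>j\<in>{1..n}. q j [^] (k j div 2 ^ i mod 2))" for i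
    have mlt_d: "mlt p (d i) = mlt p s div 2 ^ i mod 2" for p i
      unfolding d_def using mlt_q[of "\<lambda>x. x div 2 ^ i mod 2"] by simp
    have d: "d i \<in> M" if i: "i \<le> r" for i
    \<comment> \<open>(vi) needs at least one atom; for \<open>n = 0\<close> the element
      \<open>d i\<close> is the empty product.\<close>
    proof (cases "n \<ge> 1")
      case True
      have "(\<Otimes>j\<in>{1..n}. q j [^] k j) \<in> M"
        using mlt_q[of "\<lambda>x. x"] sM qG by (intro in_cong[OF sM] finprod_closed) auto
      then show ?thesis
        unfolding d_def using True q na k digits i
        by (intro dig[where k = k and r = r and c = "\<lambda>i j. k j div 2 ^ i mod 2"]) (auto simp: r_def)
    qed (simp add: d_def)
    \<comment> \<open>All digits but the lowest, shifted down by one place, so that squaring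
      \<open>w\<close> restores their weights.\<close>
    define w where "w = (\<Otimes>i\<in>{..<r}. d (Suc i) [^] ((2::nat) ^ i))"
    have w: "w \<in> M" unfolding w_def using d by (intro finprod_pow_in) auto
    have eq: "mlt p s = 2 * mlt p w + mlt p (d 0)" for p
    proof -
      have "mlt p s = (\<Sum>i\<le>r. mlt p (d i) * 2 ^ i)"
        unfolding mlt_d by (rule digits[symmetric]) (simp add: r_def count_le_size)
      also have "\<dots> = mlt p (d 0) + 2 * (\<Sum>i<r. 2 ^ i * mlt p (d (Suc i)))"
        unfolding lessThan_Suc_atMost[symmetric]
        by (subst sum.lessThan_Suc_shift) (simp add: sum_distrib_left mult_ac)
      also have "(\<Sum>i<r. 2 ^ i * mlt p (d (Suc i))) = mlt p w"
        unfolding w_def using d by (intro mlt_finprod_pow[symmetric]) (auto intro: sub_closed)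
      finally show ?thesis by simp
    qed
    have "w \<in> Units G" using squarefree_subD[OF s w d[of 0] eq] by simp
    then have "mlt p s = mlt p (d 0)" for p using eq prime_mset_eq_empty_iff[of w] w sub_closed by simp
    \<comment> \<open>Every multiplicity equals its own lowest digit.\<close>
    then have "mlt p s = mlt p s div 2 ^ 0 mod 2" for p unfolding mlt_d .
    then have lt: "mlt p s < 2" for p using mod_less_divisor[of 2] by (metis zero_less_numeral)
    have "mlt p s \<le> 1" for p using lt[of p] by linarith
    then show "s \<in> squarefree_elems G" using squarefree_iff_mlt[OF sG] by blast
  qed
qed

text \<open>\<open>pow\<close> is (v). Let \<open>t i\<close> collect, once each, the primes of
  multiplicity \<open>i\<close> in \<open>s\<close>; then \<open>s\<close> is the product of the
  \<open>t i [^] i\<close> up to a unit, and all \<open>t i\<close> lie in \<open>M\<close>. If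
  \<open>p0\<close> has multiplicity \<open>x \<ge> 2\<close>, the square of \<open>t x\<close>
  divides \<open>s\<close> in \<open>M\<close>, although \<open>p0\<close> keeps \<open>t x\<close>
  from being a unit.\<close>

lemma squarefree_of_coprime_powers_in:
  assumes pow: "\<And>(n::nat) s i. n \<ge> 1 \<Longrightarrow> (\<And>i. i \<in> {1..n} \<Longrightarrow> s i \<in> squarefree_elems G) \<Longrightarrow>
      (\<And>i j. i \<in> {1..n} \<Longrightarrow> j \<in> {1..n} \<Longrightarrow> i \<noteq> j \<Longrightarrow> rel_prime G (s i) (s j)) \<Longrightarrow>
      (\<Otimes>i\<in>{1..n}. s i [^] i) \<in> M \<Longrightarrow> i \<in> {1..n} \<Longrightarrow> s i \<in> M"
    and s: "s \<in> squarefree_elems GM"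
  shows "s \<in> squarefree_elems G"
proof (rule ccontr)
  assume not: "s \<notin> squarefree_elems G"
  have sM: "s \<in> M" using s by (simp add: squarefree_sub)
  then have sG: "s \<in> carrier G" by (rule sub_closed)
  obtain p0 where "mlt p0 s > 1" using not squarefree_iff_mlt[OF sG] by (auto simp: not_le)
  define x where "x = mlt p0 s"
  define n where "n = size (prime_mset s)"
  have le_n: "mlt p s \<le> n" for p by (simp add: n_def count_le_size)
  have "x > 1" "x \<le> n" using \<open>mlt p0 s > 1\<close> le_n by (simp_all add: x_def)
  then have x: "x \<ge> 2" "x \<in> {1..n}" by simp_all
  have "\<exists>t. t \<in> carrier G \<and> (\<forall>p. mlt p t = (if mlt p s = i then 1 else 0))" if "i \<in> {1..n}" for i
    using that transform_mlt[OF sG, of "\<lambda>x. if x = i then 1 else 0"] by (metis atLeastAtMost_iff not_one_le_zero)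
  then obtain t where t: "\<And>i. i \<in> {1..n} \<Longrightarrow> t i \<in> carrier G"
    and mlt_t: "\<And>i p. i \<in> {1..n} \<Longrightarrow> mlt p (t i) = (if mlt p s = i then 1 else 0)"
    by metis
  \<comment> \<open>The case \<open>y = 0\<close> matches no index and gives the empty value 0, so
    primes outside \<open>s\<close> are covered as well.\<close>
  have delta: "(\<Sum>i\<in>{1..n}. if y = i then i else 0) = y" if "y \<le> n" for y
    using that by auto
  have mlt_prod: "mlt p (\<Otimes>i\<in>{1..n}. t i [^] i) = mlt p s" for p
  proof -
    have "mlt p (\<Otimes>i\<in>{1..n}. t i [^] i) = (\<Sum>i\<in>{1..n}. i * mlt p (t i))"
      using t by (intro mlt_finprod_pow) auto
    also have "\<dots> = (\<Sum>i\<in>{1..n}. if mlt p s = i then i else 0)"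
      by (intro sum.cong) (auto simp: mlt_t)
    also have "\<dots> = mlt p s" using delta[OF le_n] .
    finally show ?thesis .
  qed
  have tM: "t i \<in> M" if "i \<in> {1..n}" for i
  proof (rule pow[OF _ _ _ _ that])
    show "(\<Otimes>i\<in>{1..n}. t i [^] i) \<in> M"
      using t by (intro in_cong[OF sM _ mlt_prod] finprod_closed) auto
    show "t i \<in> squarefree_elems G" if "i \<in> {1..n}" for i
      using squarefree_iff_mlt[OF t[OF that]] mlt_t[OF that] by simp
    show "rel_prime G (t i) (t j)" if "i \<in> {1..n}" "j \<in> {1..n}" "i \<noteq> j" for i j
      using that rel_prime_iff_mlt[OF t t] mlt_t by simp
  qed (use x in simp)
  \<comment> \<open>The product with two factors \<open>t x\<close> removed;
    \<open>x \<ge> 2\<close> makes the subtraction exact.\<close>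
  define d where "d = t x [^] (x - 2) \<otimes> (\<Otimes>i\<in>{1..n} - {x}. t i [^] i)"
  have prod: "(\<Otimes>i\<in>{1..n} - {x}. t i [^] i) \<in> M" using tM by (intro finprod_pow_in) auto
  then have d: "d \<in> M" unfolding d_def using tM[OF x(2)] pow_in by simp
  have "mlt p s = 2 * mlt p (t x) + mlt p d" for p
  proof -
    have "mlt p s = (\<Sum>i\<in>{1..n}. i * mlt p (t i))"
      unfolding mlt_prod[of p, symmetric] using t by (intro mlt_finprod_pow) auto
    also have "\<dots> = x * mlt p (t x) + (\<Sum>i\<in>{1..n} - {x}. i * mlt p (t i))"
      using x by (intro sum.remove) auto
    also have "(\<Sum>i\<in>{1..n} - {x}. i * mlt p (t i)) = mlt p (\<Otimes>i\<in>{1..n} - {x}. t i [^] i)"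
      using t by (intro mlt_finprod_pow[symmetric]) auto
    also have "x * mlt p (t x) = 2 * mlt p (t x) + (x - 2) * mlt p (t x)"
      using x(1) by (metis add_mult_distrib le_add_diff_inverse)
    finally show ?thesis
      using t[OF x(2)] sub_closed[OF prod] by (simp add: d_def mlt_mult mlt_pow)
  qed
  then have "t x \<in> Units G" using squarefree_subD[OF s tM[OF x(2)] d] by blast
  then have "mlt p0 (t x) = 0" using prime_mset_eq_empty_iff[OF t[OF x(2)]] by simp
  then show False using mlt_t[OF x(2), of p0] by (simp add: x_def)
qed

end

section \<open>The implications between the eight conditions\<close>

theorem theorem5p1:
  fixes H :: "('a, 'b) monoid_scheme" (structure) and M :: "'a set"
  assumes "factorial_monoid H"
    and "submonoid M H"
    and "Units (H\<lparr>carrier := M\<rparr>) = Units H"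
  shows
   "(squarefree_elems (H\<lparr>carrier := M\<rparr>) \<subseteq> squarefree_elems H \<longleftrightarrow>
      atoms (H\<lparr>carrier := M\<rparr>) \<subseteq> squarefree_elems H \<and>
      (\<forall>a\<in>M. \<forall>b\<in>M. rel_prime (H\<lparr>carrier := M\<rparr>) a b \<longrightarrow> rel_prime H a b))
  \<and> (squarefree_elems (H\<lparr>carrier := M\<rparr>) \<subseteq> squarefree_elems H \<longleftrightarrow>
      atoms (H\<lparr>carrier := M\<rparr>) \<subseteq> squarefree_elems H \<and>
      (\<forall>a\<in>atoms (H\<lparr>carrier := M\<rparr>). \<forall>b\<in>atoms (H\<lparr>carrier := M\<rparr>).
        \<not> a \<sim>\<^bsub>H\<lparr>carrier := M\<rparr>\<^esub> b \<longrightarrow> rel_prime H a b))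
  \<and> (squarefree_elems (H\<lparr>carrier := M\<rparr>) \<subseteq> squarefree_elems H \<longleftrightarrow>
      (\<exists>B. B \<subseteq> squarefree_elems H - Units H \<and> pairwise (rel_prime H) B \<and> units_times_free H M B))
  \<and> (squarefree_elems (H\<lparr>carrier := M\<rparr>) \<subseteq> squarefree_elems H \<longleftrightarrow>
      (\<forall>n\<ge>1. \<forall>s :: nat \<Rightarrow> 'a.
        (\<forall>i\<in>{1..n}. s i \<in> squarefree_elems H) \<longrightarrow>
        (\<forall>i\<in>{1..n}. \<forall>j\<in>{1..n}. i \<noteq> j \<longrightarrow> rel_prime H (s i) (s j)) \<longrightarrow>
        (\<Otimes>i\<in>{1..n}. s i [^] i) \<in> M \<longrightarrow>
        (\<forall>i\<in>{1..n}. s i \<in> M)))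
  \<and> (squarefree_elems (H\<lparr>carrier := M\<rparr>) \<subseteq> squarefree_elems H \<longleftrightarrow>
      (\<forall>n\<ge>1. \<forall>(k :: nat \<Rightarrow> nat) (q :: nat \<Rightarrow> 'a).
        (\<forall>j\<in>{1..n}. q j \<in> atoms H) \<longrightarrow>
        (\<forall>i\<in>{1..n}. \<forall>j\<in>{1..n}. i \<noteq> j \<longrightarrow> \<not> q i \<sim> q j) \<longrightarrow>
        (\<Otimes>j\<in>{1..n}. q j [^] k j) \<in> M \<longrightarrow>
        (\<forall>(r :: nat) (c :: nat \<Rightarrow> nat \<Rightarrow> nat).
          (\<forall>i\<le>r. \<forall>j\<in>{1..n}. c i j \<in> {0, 1}) \<longrightarrow>
          (\<forall>j\<in>{1..n}. k j = (\<Sum>i\<le>r. c i j * 2 ^ i)) \<longrightarrow>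
          (\<forall>i\<le>r. (\<Otimes>j\<in>{1..n}. q j [^] c i j) \<in> M))))
  \<and> (squarefree_elems (H\<lparr>carrier := M\<rparr>) \<subseteq> squarefree_elems H \<longleftrightarrow>
      (\<forall>(n :: nat) (s :: nat \<Rightarrow> 'a).
        (\<forall>i\<le>n. s i \<in> squarefree_elems H) \<longrightarrow>
        (\<Otimes>i\<in>{..n}. s i [^] ((2::nat) ^ i)) \<in> M \<longrightarrow>
        (\<forall>i\<le>n. s i \<in> M)))
  \<and> (squarefree_elems (H\<lparr>carrier := M\<rparr>) \<subseteq> squarefree_elems H \<longleftrightarrow>
      (\<forall>a\<in>carrier H. \<forall>b\<in>squarefree_elems H.
        a [^] (2::nat) \<otimes> b \<in> M \<longrightarrow> a \<in> M \<and> b \<in> M))"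
proof -
  interpret unit_submonoid H M
    by (intro unit_submonoid.intro unit_submonoid_axioms.intro assms)
  let ?S = "squarefree_elems (H\<lparr>carrier := M\<rparr>) \<subseteq> squarefree_elems H"
  let ?A = "atoms (H\<lparr>carrier := M\<rparr>) \<subseteq> squarefree_elems H"
  let ?ii = "?A \<and> (\<forall>a\<in>M. \<forall>b\<in>M. rel_prime (H\<lparr>carrier := M\<rparr>) a b \<longrightarrow> rel_prime H a b)"
  let ?iii = "?A \<and> (\<forall>a\<in>atoms (H\<lparr>carrier := M\<rparr>). \<forall>b\<in>atoms (H\<lparr>carrier := M\<rparr>).
        \<not> a \<sim>\<^bsub>H\<lparr>carrier := M\<rparr>\<^esub> b \<longrightarrow> rel_prime H a b)"
  let ?iv = "\<exists>B. B \<subseteq> squarefree_elems H - Units H \<and> pairwise (rel_prime H) B \<and> units_times_free H M B"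
  let ?v = "\<forall>n\<ge>1. \<forall>s :: nat \<Rightarrow> 'a.
        (\<forall>i\<in>{1..n}. s i \<in> squarefree_elems H) \<longrightarrow>
        (\<forall>i\<in>{1..n}. \<forall>j\<in>{1..n}. i \<noteq> j \<longrightarrow> rel_prime H (s i) (s j)) \<longrightarrow>
        (\<Otimes>i\<in>{1..n}. s i [^] i) \<in> M \<longrightarrow>
        (\<forall>i\<in>{1..n}. s i \<in> M)"
  let ?vi = "\<forall>n\<ge>1. \<forall>(k :: nat \<Rightarrow> nat) (q :: nat \<Rightarrow> 'a).
        (\<forall>j\<in>{1..n}. q j \<in> atoms H) \<longrightarrow>
        (\<forall>i\<in>{1..n}. \<forall>j\<in>{1..n}. i \<noteq> j \<longrightarrow> \<not> q i \<sim> q j) \<longrightarrow>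
        (\<Otimes>j\<in>{1..n}. q j [^] k j) \<in> M \<longrightarrow>
        (\<forall>(r :: nat) (c :: nat \<Rightarrow> nat \<Rightarrow> nat).
          (\<forall>i\<le>r. \<forall>j\<in>{1..n}. c i j \<in> {0, 1}) \<longrightarrow>
          (\<forall>j\<in>{1..n}. k j = (\<Sum>i\<le>r. c i j * 2 ^ i)) \<longrightarrow>
          (\<forall>i\<le>r. (\<Otimes>j\<in>{1..n}. q j [^] c i j) \<in> M))"
  let ?vii = "\<forall>(n :: nat) (s :: nat \<Rightarrow> 'a).
        (\<forall>i\<le>n. s i \<in> squarefree_elems H) \<longrightarrow>
        (\<Otimes>i\<in>{..n}. s i [^] ((2::nat) ^ i)) \<in> M \<longrightarrow>
        (\<forall>i\<le>n. s i \<in> M)"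
  let ?viii = "\<forall>a\<in>carrier H. \<forall>b\<in>squarefree_elems H.
        a [^] (2::nat) \<otimes> b \<in> M \<longrightarrow> a \<in> M \<and> b \<in> M"
  have assoc: "a \<sim>\<^bsub>H\<lparr>carrier := M\<rparr>\<^esub> b \<longleftrightarrow> a \<sim> b"
    if "a \<in> atoms (H\<lparr>carrier := M\<rparr>)" "b \<in> atoms (H\<lparr>carrier := M\<rparr>)" for a b
    using that associated_sub_iff by (simp add: atoms_sub)
  \<comment> \<open>The implications form two cycles: (i), (iii), (iv), (viii), (vii), (vi), (i) and
    (i), (iii), (iv), (v), (i). Condition (ii) is tied to (iii) in both directions.\<close>
  have S_iii: ?iii if ?S
    using that assoc atoms_squarefree_sub non_associated_atoms_sub_coprime by (intro conjI ballI impI) auto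
  have iii_ii: ?ii if ?iii
    using that assoc rel_prime_of_rel_prime_sub by (intro conjI ballI impI) auto
  have ii_iii: ?iii if ?ii
    using that assoc non_associated_atoms_rel_prime_sub atoms_sub by (intro conjI ballI impI) auto
  have iii_iv: ?iv if ?iii
    using that assoc by (intro free_of_coprime_atoms) auto
  have iv_viii: ?viii if iv: ?iv
  proof -
    obtain B where B: "B \<subseteq> squarefree_elems H - Units H" "pairwise (rel_prime H) B" "units_times_free H M B"
      using iv by (elim exE conjE)
    show ?thesis by (intro ballI impI) (rule square_mult_in_of_free[OF B])
  qed
  have iv_v: ?v if iv: ?iv
  proof -
    obtain B where B: "B \<subseteq> squarefree_elems H - Units H" "pairwise (rel_prime H) B" "units_times_free H M B"
      using iv by (elim exE conjE)
    show ?thesis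
    proof (intro allI impI ballI)
      fix n :: nat and s :: "nat \<Rightarrow> 'a" and i
      assume "\<forall>i\<in>{1..n}. s i \<in> squarefree_elems H"
        "\<forall>i\<in>{1..n}. \<forall>j\<in>{1..n}. i \<noteq> j \<longrightarrow> rel_prime H (s i) (s j)"
        "(\<Otimes>i\<in>{1..n}. s i [^] i) \<in> M" "i \<in> {1..n}"
      then show "s i \<in> M" by (intro coprime_powers_in_of_free[OF B, of n s]) blast+
    qed
  qed
  have v_S: ?S if v: ?v
  proof
    fix s assume "s \<in> squarefree_elems (H\<lparr>carrier := M\<rparr>)"
    then show "s \<in> squarefree_elems H"
    proof (rule squarefree_of_coprime_powers_in[rotated])
      fix n :: nat and s :: "nat \<Rightarrow> 'a" and i
      assume "n \<ge> 1" "\<And>i. i \<in> {1..n} \<Longrightarrow> s i \<in> squarefree_elems H"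
        "\<And>i j. i \<in> {1..n} \<Longrightarrow> j \<in> {1..n} \<Longrightarrow> i \<noteq> j \<Longrightarrow> rel_prime H (s i) (s j)"
        "(\<Otimes>i\<in>{1..n}. s i [^] i) \<in> M" "i \<in> {1..n}"
      then show "s i \<in> M" using v[rule_format, of n s i] by blast
    qed
  qed
  have viii_vii: ?vii if viii: ?viii
  proof (intro allI impI)
    fix n :: nat and s :: "nat \<Rightarrow> 'a" and i
    assume "\<forall>i\<le>n. s i \<in> squarefree_elems H" "(\<Otimes>i\<in>{..n}. s i [^] ((2::nat) ^ i)) \<in> M" "i \<le> n"
    then show "s i \<in> M"
      using viii by (intro binary_powers_in_of_square_mult_in[of n s]) blast+
  qed
  have vii_vi: ?vi if vii: ?vii
  proof (intro allI impI)
    fix n :: nat and k :: "nat \<Rightarrow> nat" and q :: "nat \<Rightarrow> 'a" and r :: nat and c :: "nat \<Rightarrow> nat \<Rightarrow> nat" and i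
    assume *: "\<forall>j\<in>{1..n}. q j \<in> atoms H" "\<forall>i\<in>{1..n}. \<forall>j\<in>{1..n}. i \<noteq> j \<longrightarrow> \<not> q i \<sim> q j"
      "(\<Otimes>j\<in>{1..n}. q j [^] k j) \<in> M" "\<forall>i\<le>r. \<forall>j\<in>{1..n}. c i j \<in> {0, 1}"
      "\<forall>j\<in>{1..n}. k j = (\<Sum>i\<le>r. c i j * 2 ^ i)" "i \<le> r"
    show "(\<Otimes>j\<in>{1..n}. q j [^] c i j) \<in> M"
    proof (rule binary_digits_in_of_binary_powers_in[of n q k r c i])
      show "s i \<in> M" if "\<And>i. i \<le> n \<Longrightarrow> s i \<in> squarefree_elems H"
        "(\<Otimes>i\<in>{..n}. s i [^] ((2::nat) ^ i)) \<in> M" "i \<le> n" for n s i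
        using vii that by blast
    qed (use * in blast)+
  qed
  have vi_S: ?S if vi: ?vi
  proof
    fix s assume "s \<in> squarefree_elems (H\<lparr>carrier := M\<rparr>)"
    then show "s \<in> squarefree_elems H"
    proof (rule squarefree_of_binary_digits_in[rotated])
      fix n :: nat and k :: "nat \<Rightarrow> nat" and q :: "nat \<Rightarrow> 'a" and r :: nat and c :: "nat \<Rightarrow> nat \<Rightarrow> nat" and i
      assume "n \<ge> 1" "\<And>j. j \<in> {1..n} \<Longrightarrow> q j \<in> atoms H"
        "\<And>i j. i \<in> {1..n} \<Longrightarrow> j \<in> {1..n} \<Longrightarrow> i \<noteq> j \<Longrightarrow> \<not> q i \<sim> q j"
        "(\<Otimes>j\<in>{1..n}. q j [^] k j) \<in> M"
        "\<And>i j. i \<le> r \<Longrightarrow> j \<in> {1..n} \<Longrightarrow> c i j \<in> {0, 1 :: nat}"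
        "\<And>j. j \<in> {1..n} \<Longrightarrow> k j = (\<Sum>i\<le>r. c i j * 2 ^ i)" "i \<le> r"
      then show "(\<Otimes>j\<in>{1..n}. q j [^] c i j) \<in> M"
        using vi[rule_format, of n q k r c i] by blast
    qed
  qed
  have "?S \<longleftrightarrow> ?ii" "?S \<longleftrightarrow> ?iii" "?S \<longleftrightarrow> ?iv" "?S \<longleftrightarrow> ?v" "?S \<longleftrightarrow> ?vi" "?S \<longleftrightarrow> ?vii" "?S \<longleftrightarrow> ?viii"
    using S_iii iii_ii ii_iii iii_iv iv_viii iv_v v_S viii_vii vii_vi vi_S by argo+
  then show ?thesis by (intro conjI)
qed

end
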